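(* Let $n\ge1$ and let $T:L^1(\mathbb{H}^n)\to L^\infty(\mathbb{R}^*,\mathcal{B}(L^2(\mathbb{R}^n)),d\mu)$ be a nonzero continuous linear map satisfying (i) $T(f^* )(\lambda)=(Tf)(\lambda)^*$ for all $\lambda\in\mathbb{R}^*$, $f\in L^1(\mathbb{H}^n)$; (ii) $T(f*g)(\lambda)=(Tf)(\lambda)\,(Tg)(\lambda)$ for all $\lambda\in\mathbb{R}^*$, $f,g\in L^1(\mathbb{H}^n)$; (iii) $T(R_{(z,t)}f)(\lambda)=(Tf)(\lambda)\,\pi_\lambda(z,t)^*$ for all $\lambda\in\mathbb{R}^*$, $f\in L^1(\mathbb{H}^n)$, $(z,t)\in\mathbb{H}^n$. Then $$(Tf)(\lambda)=\widehat{f}(\lambda)\quad\text{for all }\lambda\in A,\ f\in L^1(\mathbb{H}^n),$$ where $A:=\{\lambda\in\mathbb{R}^*:(Tf)(\lambda)\neq0\text{ for some }f\in L^1(\mathbb{H}^n)\}$.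
   Context: The Heisenberg group $\mathbb{H}^n$ is $\mathbb{C}^n\times\mathbb{R}$ with product $(z,t)(w,s)=\left(z+w,\,t+s+\tfrac12\operatorname{Im}(z\cdot\overline{w})\right)$ and Haar measure $dz\,dt$ (Lebesgue measure). For functions on $\mathbb{H}^n$: $(f*g)(z,t)=\int_{\mathbb{H}^n}f((z,t)(-w,-s))\,g(w,s)\,dw\,ds$, $f^*(z,t)=\overline{f(-z,-t)}$, and $(R_{(z,t)}f)(w,s)=f((w,s)(z,t))$. For $\lambda\in\mathbb{R}^*=\mathbb{R}\setminus\{0\}$, $\pi_\lambda$ is the irreducible unitary representation of $\mathbb{H}^n$ on $L^2(\mathbb{R}^n)$ given by $$\pi_\lambda(z,t)\varphi(\xi)=e^{i\lambda t}\,e^{i\lambda(x\cdot\xi+\frac12x\cdot y)}\,\varphi(\xi+y),\qquad z=x+iy,$$ and the group Fourier transform of $f\in L^1(\mathbb{H}^n)$ is $\widehat f(\lambda)=\int_{\mathbb{H}^n}f(z,t)\,\pi_\lambda(z,t)\,dz\,dt$ (weak sense). $\mathbb{R}^*$ carries the measure $d\mu(\lambda)=(2\pi)^{-n-1}|\lambda|^n\,d\lambda$, $\mathcal{B}(L^2(\mathbb{R}^n))$ is the algebra of bounded operators on $L^2(\mathbb{R}^n)$, and $L^\infty(\mathbb{R}^*,\mathcal{B}(L^2(\mathbb{R}^n)),d\mu)$ is the space of essentially bounded functions on $\mathbb{R}^*$ with values in $\mathcal{B}(L^2(\mathbb{R}^n))$. *)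

theory Defs
  imports "HOL-Analysis.Analysis"
begin

section \<open>The Hilbert space of square integrable functions\<close>

definition square_integrable :: "('a::euclidean_space \<Rightarrow> complex) \<Rightarrow> bool" where
  "square_integrable f \<longleftrightarrow>
     f \<in> borel_measurable lborel \<and> integrable lborel (\<lambda>x. (cmod (f x))\<^sup>2)"

definition l2rel :: "('a::euclidean_space \<Rightarrow> complex) \<Rightarrow> ('a \<Rightarrow> complex) \<Rightarrow> bool" where
  "l2rel f g \<longleftrightarrow> square_integrable f \<and> square_integrable g \<and> (AE x in lborel. f x = g x)"

lemma square_integrable_zero: "square_integrable (\<lambda>_. 0)"
  by (simp add: square_integrable_def)

lemma borel_measurable_cnj [measurable]: "cnj \<in> borel_measurable borel"
  by (intro borel_measurable_continuous_onI continuous_intros)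

lemma square_integrable_mult:
  assumes "square_integrable f" "square_integrable g"
  shows "integrable lborel (\<lambda>x. f x * cnj (g x))"
proof (rule Bochner_Integration.integrable_bound)
  show "integrable lborel (\<lambda>x. (cmod (f x))\<^sup>2 + (cmod (g x))\<^sup>2)"
    using assms by (auto simp: square_integrable_def)
  have [measurable]: "f \<in> borel_measurable borel" "g \<in> borel_measurable borel"
    using assms by (auto simp: square_integrable_def)
  show "(\<lambda>x. f x * cnj (g x)) \<in> borel_measurable lborel"
    by measurable
  have "a * b \<le> a\<^sup>2 + b\<^sup>2" for a b :: real
    using sum_squares_bound[of a b] zero_le_power2[of a] zero_le_power2[of b] by linarith
  then show "AE x in lborel. norm (f x * cnj (g x)) \<le> norm ((cmod (f x))\<^sup>2 + (cmod (g x))\<^sup>2)"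
    by (auto simp: norm_mult)
qed

lemma square_integrable_add:
  assumes "square_integrable f" "square_integrable g"
  shows "square_integrable (\<lambda>x. f x + g x)"
proof -
  have [measurable]: "f \<in> borel_measurable borel" "g \<in> borel_measurable borel"
    using assms by (auto simp: square_integrable_def)
  have "integrable lborel (\<lambda>x. (cmod (f x + g x))\<^sup>2)"
  proof (rule Bochner_Integration.integrable_bound)
    show "integrable lborel (\<lambda>x. 2 * (cmod (f x))\<^sup>2 + 2 * (cmod (g x))\<^sup>2)"
      using assms by (auto simp: square_integrable_def)
    show "(\<lambda>x. (cmod (f x + g x))\<^sup>2) \<in> borel_measurable lborel"
      by measurable
    have "(cmod (a + b))\<^sup>2 \<le> 2 * (cmod a)\<^sup>2 + 2 * (cmod b)\<^sup>2" for a b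
    proof -
      have "(cmod (a + b))\<^sup>2 \<le> (cmod a + cmod b)\<^sup>2"
        by (simp add: norm_triangle_ineq power_mono)
      also have "\<dots> \<le> 2 * (cmod a)\<^sup>2 + 2 * (cmod b)\<^sup>2"
        using sum_squares_bound[of "cmod a" "cmod b"] by (simp add: power2_sum)
      finally show ?thesis .
    qed
    then show "AE x in lborel. norm ((cmod (f x + g x))\<^sup>2)
        \<le> norm (2 * (cmod (f x))\<^sup>2 + 2 * (cmod (g x))\<^sup>2)"
      by auto
  qed
  then show ?thesis
    by (simp add: square_integrable_def)
qed

lemma square_integrable_cmult:
  assumes "square_integrable f"
  shows "square_integrable (\<lambda>x. c * f x)"
  using assms by (auto simp: square_integrable_def norm_mult power_mult_distrib)

quotient_type (overloaded) 'a l2 = "'a::euclidean_space \<Rightarrow> complex" / partial: l2rel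
proof (rule part_equivpI)
  show "\<exists>f::'a \<Rightarrow> complex. l2rel f f"
    using square_integrable_zero by (auto simp: l2rel_def)
  show "symp (l2rel :: ('a \<Rightarrow> complex) \<Rightarrow> _)"
    by (auto simp: symp_def l2rel_def)
  show "transp (l2rel :: ('a \<Rightarrow> complex) \<Rightarrow> _)"
    by (auto simp: transp_def l2rel_def)
qed

lift_definition cinner_l2 :: "'a::euclidean_space l2 \<Rightarrow> 'a l2 \<Rightarrow> complex" is
  "\<lambda>f g. \<integral>x. f x * cnj (g x) \<partial>lborel"
  by (rule integral_cong_AE)
     (auto simp: l2rel_def square_integrable_def)

lift_definition scaleC_l2 :: "complex \<Rightarrow> 'a::euclidean_space l2 \<Rightarrow> 'a l2" is
  "\<lambda>c f x. c * f x"
  by (auto simp: l2rel_def square_integrable_cmult)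

instantiation l2 :: (euclidean_space) real_inner
begin

lift_definition zero_l2 :: "'a l2" is "\<lambda>_. 0"
  by (auto simp: l2rel_def square_integrable_zero)

lift_definition plus_l2 :: "'a l2 \<Rightarrow> 'a l2 \<Rightarrow> 'a l2" is "\<lambda>f g x. f x + g x"
  by (auto simp: l2rel_def square_integrable_add)

definition scaleR_l2 :: "real \<Rightarrow> 'a l2 \<Rightarrow> 'a l2" where
  "scaleR_l2 r f = scaleC_l2 (complex_of_real r) f"

definition uminus_l2 :: "'a l2 \<Rightarrow> 'a l2" where
  "uminus_l2 f = scaleC_l2 (- 1) f"

definition minus_l2 :: "'a l2 \<Rightarrow> 'a l2 \<Rightarrow> 'a l2" where
  "minus_l2 f g = f + (- g)"

definition inner_l2 :: "'a l2 \<Rightarrow> 'a l2 \<Rightarrow> real" where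
  "inner_l2 f g = Re (cinner_l2 f g)"

definition norm_l2 :: "'a l2 \<Rightarrow> real" where
  "norm_l2 f = sqrt (inner f f)"

definition sgn_l2 :: "'a l2 \<Rightarrow> 'a l2" where
  "sgn_l2 f = scaleR (inverse (norm f)) f"

definition dist_l2 :: "'a l2 \<Rightarrow> 'a l2 \<Rightarrow> real" where
  "dist_l2 f g = norm (f - g)"

definition uniformity_l2 :: "('a l2 \<times> 'a l2) filter" where
  "uniformity_l2 = (INF e\<in>{0 <..}. principal {(x, y). dist x y < e})"

definition open_l2 :: "'a l2 set \<Rightarrow> bool" where
  "open_l2 U \<longleftrightarrow> (\<forall>x\<in>U. eventually (\<lambda>(x', y). x' = x \<longrightarrow> y \<in> U) uniformity)"

instance
proof
  fix a b c :: "'a l2" and r s :: real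
  show "a + b + c = a + (b + c)"
    by transfer (auto simp: l2rel_def add.assoc intro!: square_integrable_add)
  show "a + b = b + a"
    by transfer (auto simp: l2rel_def add.commute intro!: square_integrable_add)
  show "0 + a = a"
    by transfer (auto simp: l2rel_def)
  show "- a + a = 0"
    unfolding uminus_l2_def by transfer (auto simp: l2rel_def square_integrable_zero)
  show "a - b = a + - b"
    by (simp add: minus_l2_def)
  show "r *\<^sub>R (a + b) = r *\<^sub>R a + r *\<^sub>R b"
    unfolding scaleR_l2_def
    by transfer (auto simp: l2rel_def distrib_left distrib_right intro!: square_integrable_add square_integrable_cmult)
  show "(r + s) *\<^sub>R a = r *\<^sub>R a + s *\<^sub>R a"
    unfolding scaleR_l2_def
    by transfer (auto simp: l2rel_def distrib_left distrib_right intro!: square_integrable_add square_integrable_cmult)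
  show "r *\<^sub>R s *\<^sub>R a = (r * s) *\<^sub>R a"
    unfolding scaleR_l2_def
    by transfer (auto simp: l2rel_def mult.assoc intro!: square_integrable_cmult)
  show "1 *\<^sub>R a = a"
    unfolding scaleR_l2_def by transfer (auto simp: l2rel_def)
  show "sgn a = scaleR (inverse (norm a)) a" "dist a b = norm (a - b)" "norm a = sqrt (inner a a)"
    by (simp_all add: sgn_l2_def dist_l2_def norm_l2_def)
  show "uniformity = (INF e\<in>{0 <..}. principal {(x, y :: 'a l2). dist x y < e})"
    by (rule uniformity_l2_def)
  show "open U \<longleftrightarrow> (\<forall>x\<in>U. eventually (\<lambda>(x', y). x' = x \<longrightarrow> y \<in> U) uniformity)"
    for U :: "'a l2 set"
    by (rule open_l2_def)
  show "inner a b = inner b a"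
    unfolding inner_l2_def
  proof transfer
    fix f g :: "'a \<Rightarrow> complex"
    have "(\<integral>x. g x * cnj (f x) \<partial>lborel) = (\<integral>x. cnj (f x * cnj (g x)) \<partial>lborel)"
      by (simp add: mult.commute)
    also have "\<dots> = cnj (\<integral>x. f x * cnj (g x) \<partial>lborel)"
      by (rule Bochner_Integration.integral_cnj)
    finally show "Re (\<integral>x. f x * cnj (g x) \<partial>lborel) = Re (\<integral>x. g x * cnj (f x) \<partial>lborel)"
      by simp
  qed
  show "inner (a + b) c = inner a c + inner b c"
    unfolding inner_l2_def
    by transfer (simp add: l2rel_def distrib_right square_integrable_mult)
  show "inner (r *\<^sub>R a) b = r * inner a b"
    unfolding inner_l2_def scaleR_l2_def
    by transfer (simp add: mult.assoc)
  have *: "inner a a = (\<integral>x. (cmod (f x))\<^sup>2 \<partial>lborel)" if "a = abs_l2 f" "square_integrable f" for f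
  proof -
    have "inner a a = Re (\<integral>x. f x * cnj (f x) \<partial>lborel)"
      using that by (simp add: inner_l2_def cinner_l2.abs_eq l2rel_def)
    also have "(\<integral>x. f x * cnj (f x) \<partial>lborel) = (\<integral>x. complex_of_real ((cmod (f x))\<^sup>2) \<partial>lborel)"
      by (simp only: complex_norm_square)
    finally show ?thesis
      by (simp only: integral_complex_of_real Re_complex_of_real)
  qed
  obtain f where f: "a = abs_l2 f" "square_integrable f"
    using Quotient_abs_rep[OF Quotient_l2, of a] Quotient_rep_reflp[OF Quotient_l2, of a]
    by (metis l2rel_def)
  show "0 \<le> inner a a"
    unfolding *[OF f] by simp
  have "inner a a = 0 \<longleftrightarrow> (AE x in lborel. (cmod (f x))\<^sup>2 = 0)"
    unfolding *[OF f] using f(2)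
    by (intro integral_nonneg_eq_0_iff_AE) (auto simp: square_integrable_def)
  also have "\<dots> \<longleftrightarrow> l2rel f (\<lambda>_. 0)"
    using f(2) by (simp add: l2rel_def square_integrable_zero)
  also have "\<dots> \<longleftrightarrow> a = 0"
    unfolding f(1) zero_l2_def
    using Quotient_rel[OF Quotient_l2, of f "\<lambda>_. 0"] f(2)
    by (auto simp: l2rel_def square_integrable_zero)
  finally show "inner a a = 0 \<longleftrightarrow> a = 0" .
qed

end


section \<open>Bounded operators\<close>

text \<open>
  The type of bounded linear functions of the library is only real linear; complex
  linearity singles out \<open>\<B>(L\<^sup>2)\<close> in it. The norm is the operator norm in either case.
\<close>

type_synonym 'a l2_op = "'a l2 \<Rightarrow>\<^sub>L 'a l2"

definition bounded_ops :: "'a::euclidean_space l2_op set" where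
  "bounded_ops = {A. \<forall>c \<phi>. blinfun_apply A (scaleC_l2 c \<phi>) = scaleC_l2 c (blinfun_apply A \<phi>)}"

definition op_adjoint :: "'a::euclidean_space l2_op \<Rightarrow> 'a l2_op" where
  "op_adjoint A = (THE B. B \<in> bounded_ops \<and>
     (\<forall>\<phi> \<psi>. cinner_l2 (blinfun_apply A \<phi>) \<psi> = cinner_l2 \<phi> (blinfun_apply B \<psi>)))"


section \<open>The Heisenberg group\<close>

type_synonym 'n heis = "(complex ^ 'n) \<times> real"

definition heis_mult :: "'n::finite heis \<Rightarrow> 'n heis \<Rightarrow> 'n heis" where
  "heis_mult p q =
     (fst p + fst q, snd p + snd q + Im (\<Sum>j\<in>UNIV. fst p $ j * cnj (fst q $ j)) / 2)"

definition heis_L1 :: "('n::finite heis \<Rightarrow> complex) set" where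
  "heis_L1 = {f. integrable lborel f}"

definition L1_norm :: "('n::finite heis \<Rightarrow> complex) \<Rightarrow> real" where
  "L1_norm f = (\<integral>p. cmod (f p) \<partial>lborel)"

definition heis_conv ::
    "('n::finite heis \<Rightarrow> complex) \<Rightarrow> ('n heis \<Rightarrow> complex) \<Rightarrow> 'n heis \<Rightarrow> complex" where
  "heis_conv f g p = (\<integral>q. f (heis_mult p (- q)) * g q \<partial>lborel)"

definition heis_star :: "('n::finite heis \<Rightarrow> complex) \<Rightarrow> 'n heis \<Rightarrow> complex" where
  "heis_star f p = cnj (f (- p))"

definition heis_translate :: "'n::finite heis \<Rightarrow> ('n heis \<Rightarrow> complex) \<Rightarrow> 'n heis \<Rightarrow> complex" where
  "heis_translate p f q = f (heis_mult q p)"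


section \<open>The Schroedinger representation and the group Fourier transform\<close>

definition Re_vec :: "complex ^ 'n \<Rightarrow> real ^ 'n" where
  "Re_vec z = (\<chi> j. Re (z $ j))"

definition Im_vec :: "complex ^ 'n \<Rightarrow> real ^ 'n" where
  "Im_vec z = (\<chi> j. Im (z $ j))"

definition schroedinger_fun ::
    "real \<Rightarrow> 'n::finite heis \<Rightarrow> (real ^ 'n \<Rightarrow> complex) \<Rightarrow> real ^ 'n \<Rightarrow> complex" where
  "schroedinger_fun l p \<phi> \<xi> =
     (let x = Re_vec (fst p); y = Im_vec (fst p); t = snd p
      in exp (\<i> * complex_of_real (l * t)) *
         exp (\<i> * complex_of_real (l * (inner x \<xi> + inner x y / 2))) * \<phi> (\<xi> + y))"

lemma lborel_distr_plus_right: "distr lborel borel (\<lambda>x. x + c) = (lborel :: 'a::euclidean_space measure)"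
  using lborel_distr_plus[of c] by (simp add: add.commute[of _ c])

lemma AE_lborel_translate:
  fixes c :: "'a::euclidean_space"
  assumes "AE x in lborel. P x"
  shows "AE x in lborel. P (x + c)"
proof -
  have "AE x in distr lborel borel (\<lambda>x::'a. x + c). P x"
    using assms by (subst lborel_distr_plus_right)
  then show ?thesis
    by (rule AE_distrD[rotated]) simp
qed

lemma cmod_schroedinger_fun: "cmod (schroedinger_fun l p \<phi> \<xi>) = cmod (\<phi> (\<xi> + Im_vec (fst p)))"
  by (simp add: schroedinger_fun_def Let_def norm_mult)

lemma schroedinger_fun_add:
  "schroedinger_fun l p (\<lambda>\<xi>. \<phi> \<xi> + \<psi> \<xi>) = (\<lambda>\<xi>. schroedinger_fun l p \<phi> \<xi> + schroedinger_fun l p \<psi> \<xi>)"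
  by (rule ext) (simp add: schroedinger_fun_def Let_def distrib_left)

lemma schroedinger_fun_cmult:
  "schroedinger_fun l p (\<lambda>\<xi>. c * \<phi> \<xi>) = (\<lambda>\<xi>. c * schroedinger_fun l p \<phi> \<xi>)"
  by (rule ext) (simp add: schroedinger_fun_def Let_def)

lemma square_integrable_schroedinger_fun:
  assumes "square_integrable \<phi>"
  shows "square_integrable (schroedinger_fun l p \<phi>)"
proof -
  have [measurable]: "\<phi> \<in> borel_measurable borel"
    using assms by (auto simp: square_integrable_def)
  have "integrable (distr lborel borel (\<lambda>\<xi>. \<xi> + Im_vec (fst p))) (\<lambda>\<xi>. (cmod (\<phi> \<xi>))\<^sup>2)"
    using assms unfolding lborel_distr_plus_right by (simp add: square_integrable_def)
  then have "integrable lborel (\<lambda>\<xi>. (cmod (\<phi> (\<xi> + Im_vec (fst p))))\<^sup>2)"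
    by (subst (asm) integrable_distr_eq) auto
  then show ?thesis
    unfolding square_integrable_def cmod_schroedinger_fun
    by (simp add: schroedinger_fun_def[abs_def] Let_def)
qed

lift_definition schroedinger_l2 :: "real \<Rightarrow> 'n::finite heis \<Rightarrow> (real ^ 'n) l2 \<Rightarrow> (real ^ 'n) l2"
  is schroedinger_fun
proof -
  fix l and p :: "'n heis" and \<phi> \<psi> :: "real ^ 'n \<Rightarrow> complex"
  assume "l2rel \<phi> \<psi>"
  moreover from this have "AE \<xi> in lborel. \<phi> (\<xi> + Im_vec (fst p)) = \<psi> (\<xi> + Im_vec (fst p))"
    by (intro AE_lborel_translate) (simp add: l2rel_def)
  ultimately show "l2rel (schroedinger_fun l p \<phi>) (schroedinger_fun l p \<psi>)"
    by (auto simp: l2rel_def square_integrable_schroedinger_fun schroedinger_fun_def Let_def)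
qed

lemma norm_schroedinger_l2: "norm (schroedinger_l2 l p \<phi>) = norm \<phi>"
  for p :: "'n::finite heis"
proof -
  have "cinner_l2 (schroedinger_l2 l p \<phi>) (schroedinger_l2 l p \<phi>) = cinner_l2 \<phi> \<phi>"
  proof transfer
    fix l and p :: "'n heis" and \<phi> :: "real ^ 'n \<Rightarrow> complex"
    assume "l2rel \<phi> \<phi>"
    then have [measurable]: "\<phi> \<in> borel_measurable borel"
      by (auto simp: l2rel_def square_integrable_def)
    have "(\<integral>\<xi>. schroedinger_fun l p \<phi> \<xi> * cnj (schroedinger_fun l p \<phi> \<xi>) \<partial>lborel)
        = (\<integral>\<xi>. \<phi> (\<xi> + Im_vec (fst p)) * cnj (\<phi> (\<xi> + Im_vec (fst p))) \<partial>lborel)"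
      by (simp only: complex_norm_square[symmetric] cmod_schroedinger_fun)
    also have "\<dots> = (\<integral>\<xi>. \<phi> \<xi> * cnj (\<phi> \<xi>) \<partial>distr lborel borel (\<lambda>\<xi>. \<xi> + Im_vec (fst p)))"
      by (subst integral_distr) auto
    finally show "(\<integral>\<xi>. schroedinger_fun l p \<phi> \<xi> * cnj (schroedinger_fun l p \<phi> \<xi>) \<partial>lborel)
        = (\<integral>\<xi>. \<phi> \<xi> * cnj (\<phi> \<xi>) \<partial>lborel)"
      by (simp only: lborel_distr_plus_right)
  qed
  then show ?thesis
    by (simp add: norm_l2_def inner_l2_def)
qed

lift_definition schroedinger :: "real \<Rightarrow> 'n::finite heis \<Rightarrow> (real ^ 'n) l2_op"
  is schroedinger_l2
proof (rule bounded_linear_intro[where K = 1])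
  fix l r and p :: "'n heis" and \<phi> \<psi> :: "(real ^ 'n) l2"
  show "schroedinger_l2 l p (\<phi> + \<psi>) = schroedinger_l2 l p \<phi> + schroedinger_l2 l p \<psi>"
    by transfer
       (auto simp: l2rel_def schroedinger_fun_add
          intro!: square_integrable_add square_integrable_schroedinger_fun)
  show "schroedinger_l2 l p (r *\<^sub>R \<phi>) = r *\<^sub>R schroedinger_l2 l p \<phi>"
    unfolding scaleR_l2_def
    by transfer
       (auto simp: l2rel_def schroedinger_fun_cmult
          intro!: square_integrable_cmult square_integrable_schroedinger_fun)
  show "norm (schroedinger_l2 l p \<phi>) \<le> norm \<phi> * 1"
    by (simp add: norm_schroedinger_l2)
qed

text \<open>The operator-valued integral is meant in the weak sense.\<close>

definition group_fourier :: "('n::finite heis \<Rightarrow> complex) \<Rightarrow> real \<Rightarrow> (real ^ 'n) l2_op" where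
  "group_fourier f l = (THE B. B \<in> bounded_ops \<and>
     (\<forall>\<phi> \<psi>. cinner_l2 (blinfun_apply B \<phi>) \<psi> =
        (\<integral>p. f p * cinner_l2 (blinfun_apply (schroedinger l p) \<phi>) \<psi> \<partial>lborel)))"


section \<open>Essentially bounded operator-valued functions\<close>

definition plancherel_measure :: "nat \<Rightarrow> real measure" where
  "plancherel_measure n =
     density (restrict_space lborel {l. l \<noteq> 0}) (\<lambda>l. ennreal (\<bar>l\<bar> ^ n / (2 * pi) ^ (n + 1)))"

text \<open>
  Elements of \<open>L\<^sup>\<infinity>\<close> are genuine functions on the nonzero reals, not classes modulo null
  sets, so that their values at a single point are meaningful; a function is total in HOL and
  its value at 0 plays no role. Measurability is understood in the weak operator sense.
\<close>

definition Linfty_ops :: "(real \<Rightarrow> (real ^ 'n::finite) l2_op) set" where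
  "Linfty_ops = {F. (\<forall>l. l \<noteq> 0 \<longrightarrow> F l \<in> bounded_ops) \<and>
     (\<forall>\<phi> \<psi>. (\<lambda>l. cinner_l2 (blinfun_apply (F l) \<phi>) \<psi>)
        \<in> borel_measurable (plancherel_measure CARD('n))) \<and>
     (\<exists>C. AE l in plancherel_measure CARD('n). norm (F l) \<le> C)}"

definition Linfty_norm :: "(real \<Rightarrow> (real ^ 'n::finite) l2_op) \<Rightarrow> real" where
  "Linfty_norm F = Inf {C. 0 \<le> C \<and> (AE l in plancherel_measure CARD('n). norm (F l) \<le> C)}"

definition linear_into_ops ::
    "(('n::finite heis \<Rightarrow> complex) \<Rightarrow> real \<Rightarrow> (real ^ 'n) l2_op) \<Rightarrow> bool" where
  "linear_into_ops T \<longleftrightarrow>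
     (\<forall>f\<in>heis_L1. \<forall>g\<in>heis_L1. \<forall>a b l \<phi>. l \<noteq> 0 \<longrightarrow>
        blinfun_apply (T (\<lambda>p. a * f p + b * g p) l) \<phi> =
          scaleC_l2 a (blinfun_apply (T f l) \<phi>) + scaleC_l2 b (blinfun_apply (T g l) \<phi>))"

definition continuous_into_ops ::
    "(('n::finite heis \<Rightarrow> complex) \<Rightarrow> real \<Rightarrow> (real ^ 'n) l2_op) \<Rightarrow> bool" where
  "continuous_into_ops T \<longleftrightarrow>
     (\<forall>f\<in>heis_L1. \<forall>\<epsilon>>0. \<exists>\<delta>>0. \<forall>g\<in>heis_L1.
        L1_norm (\<lambda>p. g p - f p) < \<delta> \<longrightarrow> Linfty_norm (\<lambda>l. T g l - T f l) < \<epsilon>)"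

text \<open>
  A map on \<open>L\<^sup>1\<close> is given on integrable functions, so it has to be constant on classes modulo
  almost everywhere equality.
\<close>

definition L1_Linfty_map ::
    "(('n::finite heis \<Rightarrow> complex) \<Rightarrow> real \<Rightarrow> (real ^ 'n) l2_op) \<Rightarrow> bool" where
  "L1_Linfty_map T \<longleftrightarrow>
     (\<forall>f\<in>heis_L1. T f \<in> Linfty_ops) \<and>
     (\<forall>f\<in>heis_L1. \<forall>g\<in>heis_L1. (AE p in lborel. f p = g p) \<longrightarrow> (\<forall>l. l \<noteq> 0 \<longrightarrow> T f l = T g l))"

end

theory Submission
  imports Defs "HOL-Probability.Probability"
begin

text \<open>
  Fix \<open>\<lambda> \<noteq> 0\<close> such that \<open>B f = (T f)(\<lambda>)\<close> does not vanish identically. The map \<open>B\<close> is a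
  homomorphism of involutive algebras from \<open>L\<^sup>1\<close> of the Heisenberg group to the bounded
  operators, and any such homomorphism is contractive (lemma \<open>contractive\<close>): if
  \<open>\<parallel>f\<parallel> < \<parallel>B f\<parallel>\<close>, then \<open>1 - (B f)\<^sup>* (B f) / \<parallel>B f\<parallel>\<^sup>2\<close> would have a left inverse, given by a Neumann series in \<open>L\<^sup>1\<close>,
  although it is not bounded below.

  Contractivity is what allows coefficients of \<open>B\<close> to be taken under integrals of
  \<open>L\<^sup>1\<close> functions (lemma \<open>functional_integral_commute\<close>). Since \<open>f * g\<close> is the integral of
  \<open>g(q) R_{-q} f\<close> over \<open>q\<close>, and \<open>B (R_{-q} f) = (B f) \<pi>(-q)\<^sup>* = (B f) \<pi>(q)\<close> by covariance, one obtains
  \<open>(B f) (B g) = (B f) \<integral> g(q) \<pi>(q) dq\<close> weakly. With \<open>f\<^sup>*\<close> for \<open>f\<close> this says that \<open>B g\<close> and the group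
  Fourier transform of \<open>g\<close> have the same coefficients against all vectors in the range of any
  \<open>B f\<close> (lemma \<open>weak_formula_on_range\<close>).

  The difference of the two coefficients is a bounded functional of the second vector, so by
  the Riesz theorem it is the inner product with some \<open>w\<close> orthogonal to all these ranges. By
  covariance every \<open>\<pi>(p) w\<close> is orthogonal to them too, and they contain a nonzero vector. As the
  Schroedinger representation is irreducible, \<open>w = 0\<close> (lemma \<open>weak_formula\<close>). Irreducibility is
  used in the form that \<open>\<langle>\<pi>(p) \<phi>, \<psi>\<rangle> = 0\<close> for all \<open>p\<close> forces \<open>\<phi> = 0\<close> or \<open>\<psi> = 0\<close>
  (lemma \<open>schroedinger_coefficients_zero\<close>), which comes down to the injectivity of the Fourier
  transform on \<open>L\<^sup>1(\<real>\<^sup>n)\<close>. The existence of adjoints and of \<open>w\<close> rests on the completeness of \<open>L\<^sup>2\<close>.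
\<close>

section \<open>The Riesz representation theorem\<close>

text \<open>
  The representing vector is where the concave functional \<open>2 F x - \<parallel>x\<parallel>\<^sup>2\<close> attains its maximum:
  by the parallelogram law every maximizing sequence is Cauchy, and the first variation at the
  maximum is the identity \<open>F v = w \<bullet> v\<close>.
\<close>

lemma riesz_representation:
  fixes F :: "'a::{real_inner,complete_space} \<Rightarrow> real"
  assumes "bounded_linear F"
  shows "\<exists>w. \<forall>v. F v = inner w v"
proof -
  interpret F: bounded_linear F by fact
  obtain K where K: "\<And>x. \<bar>F x\<bar> \<le> norm x * K"
    using F.bounded by auto
  define J where "J x = 2 * F x - (norm x)\<^sup>2" for x
  have J_bound: "J x \<le> K\<^sup>2" for x
  proof -
    have "2 * F x \<le> 2 * (norm x * K)"
      using K[of x] by linarith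
    also have "\<dots> \<le> (norm x)\<^sup>2 + K\<^sup>2"
      using sum_squares_bound[of "norm x" K] by simp
    finally show ?thesis by (simp add: J_def)
  qed
  define s where "s = (SUP x. J x)"
  have bdd: "bdd_above (range J)"
    using J_bound by (auto intro!: bdd_aboveI)
  have J_le: "J x \<le> s" for x
    unfolding s_def by (rule cSUP_upper[OF _ bdd]) simp
  have "\<exists>x. s - 1 / real (Suc n) < J x" for n
    using less_cSUP_iff[OF _ bdd, of "s - 1 / real (Suc n)"] by (auto simp: s_def)
  then obtain X where X: "\<And>n. s - 1 / real (Suc n) < J (X n)"
    by metis
  have parallelogram: "(norm (x - y))\<^sup>2 = 2 * (2 * J ((1/2) *\<^sub>R (x + y)) - J x - J y)" for x y
    unfolding J_def power2_norm_eq_inner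
    by (simp add: F.scaleR F.add inner_add_left inner_add_right inner_diff_left inner_diff_right
        inner_commute algebra_simps)
  have dist_X: "(norm (X m - X n))\<^sup>2 \<le> 2 * (1 / real (Suc m) + 1 / real (Suc n))" for m n
    unfolding parallelogram
    using J_le[of "(1/2) *\<^sub>R (X m + X n)"] X[of m] X[of n] by simp
  have "Cauchy X"
  proof (rule metric_CauchyI)
    fix e :: real assume "e > 0"
    obtain N where N: "4 / e\<^sup>2 < real (Suc N)"
      using reals_Archimedean2[of "4 / e\<^sup>2"] by (metis less_trans lessI of_nat_less_iff)
    show "\<exists>M. \<forall>m\<ge>M. \<forall>n\<ge>M. dist (X m) (X n) < e"
    proof (intro exI allI impI)
      fix m n assume "N \<le> m" "N \<le> n"
      then have "1 / real (Suc m) \<le> 1 / real (Suc N)" "1 / real (Suc n) \<le> 1 / real (Suc N)"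
        by (auto intro!: divide_left_mono)
      then have "(norm (X m - X n))\<^sup>2 \<le> 4 / real (Suc N)"
        using dist_X[of m n] by simp
      also have "\<dots> < e\<^sup>2"
        using N \<open>e > 0\<close> by (simp add: field_simps)
      finally show "dist (X m) (X n) < e"
        using \<open>e > 0\<close> by (simp add: dist_norm power2_less_imp_less)
    qed
  qed
  then obtain w where w: "X \<longlonglongrightarrow> w"
    using Cauchy_convergent convergentD by blast
  have "(\<lambda>n. J (X n)) \<longlonglongrightarrow> J w"
    unfolding J_def by (intro tendsto_intros F.tendsto w)
  moreover have "(\<lambda>n. s - 1 / real (Suc n)) \<longlonglongrightarrow> s - 0"
    by (intro tendsto_intros LIMSEQ_Suc[OF lim_1_over_n])
  ultimately have "s \<le> J w"
    using X by (auto intro: LIMSEQ_le less_imp_le)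
  have "F v = inner w v" for v
  proof -
    define d where "d = F v - inner w v"
    define t where "t = d / ((norm v)\<^sup>2 + 1)"
    have pos: "(norm v)\<^sup>2 + 1 > 0"
      by (simp add: add_nonneg_pos)
    have "J (w + t *\<^sub>R v) \<le> J w"
      using J_le[of "w + t *\<^sub>R v"] \<open>s \<le> J w\<close> by linarith
    then have "2 * t * d \<le> t\<^sup>2 * (norm v)\<^sup>2"
      unfolding J_def d_def power2_norm_eq_inner
      by (simp add: F.scaleR F.add inner_add_left inner_add_right inner_commute power2_eq_square
          algebra_simps)
    also have "\<dots> \<le> t\<^sup>2 * ((norm v)\<^sup>2 + 1)"
      by (simp add: mult_left_mono)
    also have "\<dots> = t * d"
      using pos by (simp add: t_def power2_eq_square)
    finally have "t * d \<le> 0" by linarith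
    then have "d\<^sup>2 \<le> 0"
      using pos by (simp add: t_def power2_eq_square divide_le_0_iff)
    then show ?thesis by (simp add: d_def)
  qed
  then show ?thesis by blast
qed


section \<open>Completeness of the space of square integrable functions\<close>

lemma AE_summable_of_summable_integral:
  fixes f :: "nat \<Rightarrow> 'a \<Rightarrow> real"
  assumes int: "\<And>i. integrable M (f i)" and nonneg: "\<And>i x. 0 \<le> f i x"
    and "summable (\<lambda>i. \<integral>x. f i x \<partial>M)"
  shows "AE x in M. summable (\<lambda>i. f i x)"
proof -
  have "(\<integral>\<^sup>+x. (\<Sum>i. ennreal (f i x)) \<partial>M) = (\<Sum>i. \<integral>\<^sup>+x. ennreal (f i x) \<partial>M)"
    using int by (intro nn_integral_suminf) auto
  also have "\<dots> = (\<Sum>i. ennreal (\<integral>x. f i x \<partial>M))"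
    using int nonneg by (simp add: nn_integral_eq_integral)
  also have "\<dots> = ennreal (\<Sum>i. \<integral>x. f i x \<partial>M)"
    using assms by (intro suminf_ennreal2) auto
  finally have "AE x in M. (\<Sum>i. ennreal (f i x)) \<noteq> \<infinity>"
    using int by (intro nn_integral_PInf_AE) auto
  then show ?thesis
    by eventually_elim (use nonneg in \<open>auto intro!: summable_suminf_not_top\<close>)
qed

lemma convergent_of_summable_diff:
  fixes u :: "nat \<Rightarrow> 'a::banach"
  assumes "summable (\<lambda>k. norm (u (Suc k) - u k))"
  shows "convergent u"
proof -
  have "summable (\<lambda>k. u (Suc k) - u k)"
    using assms by (rule summable_norm_cancel)
  then have "convergent (\<lambda>n. \<Sum>k<n. u (Suc k) - u k)"
    by (simp add: summable_iff_convergent)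
  then have "convergent (\<lambda>n. u 0 + (\<Sum>k<n. u (Suc k) - u k))"
    by (intro convergent_add convergent_const)
  then show ?thesis
    by (simp add: sum_lessThan_telescope)
qed

lemma l2_cases:
  obtains f where "square_integrable f" "a = abs_l2 f"
  using Quotient_abs_rep[OF Quotient_l2, of a] Quotient_rep_reflp[OF Quotient_l2, of a]
  by (metis l2rel_def)

lemma scaleC_abs_l2: "square_integrable f \<Longrightarrow> scaleC_l2 c (abs_l2 f) = abs_l2 (\<lambda>x. c * f x)"
  by (simp add: scaleC_l2.abs_eq l2rel_def)

lemma add_abs_l2:
  "square_integrable f \<Longrightarrow> square_integrable g \<Longrightarrow> abs_l2 f + abs_l2 g = abs_l2 (\<lambda>x. f x + g x)"
  by (simp add: plus_l2.abs_eq l2rel_def)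

lemma diff_abs_l2:
  "square_integrable f \<Longrightarrow> square_integrable g \<Longrightarrow> abs_l2 f - abs_l2 g = abs_l2 (\<lambda>x. f x - g x)"
  by (simp add: minus_l2_def uminus_l2_def scaleC_abs_l2 add_abs_l2 square_integrable_cmult
      square_integrable_cmult[of g "-1", simplified])

lemma cinner_abs_l2:
  "square_integrable f \<Longrightarrow> square_integrable g \<Longrightarrow>
    cinner_l2 (abs_l2 f) (abs_l2 g) = (\<integral>x. f x * cnj (g x) \<partial>lborel)"
  by (simp add: cinner_l2.abs_eq l2rel_def)

lemma square_integrable_diff:
  "square_integrable f \<Longrightarrow> square_integrable g \<Longrightarrow> square_integrable (\<lambda>x. f x - g x)"
  using square_integrable_add[of f "\<lambda>x. -1 * g x"] square_integrable_cmult[of g "-1"] by simp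

lemma norm_abs_l2:
  assumes "square_integrable f"
  shows "(norm (abs_l2 f))\<^sup>2 = (\<integral>x. (cmod (f x))\<^sup>2 \<partial>lborel)"
proof -
  have "(norm (abs_l2 f))\<^sup>2 = Re (\<integral>x. f x * cnj (f x) \<partial>lborel)"
    using assms by (simp add: power2_norm_eq_inner inner_l2_def cinner_abs_l2)
  also have "(\<integral>x. f x * cnj (f x) \<partial>lborel) = (\<integral>x. complex_of_real ((cmod (f x))\<^sup>2) \<partial>lborel)"
    by (simp only: complex_norm_square)
  finally show ?thesis
    by (simp only: integral_complex_of_real Re_complex_of_real)
qed

text \<open>
  Along a subsequence with \<open>\<parallel>f (k+1) - f k\<parallel> \<le> 2\<^sup>-\<^sup>k\<close> the functions converge
  almost everywhere: the weighted squares \<open>2\<^sup>k \<bar>f (k+1) - f k\<bar>\<^sup>2\<close> have summable integrals, and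
  \<open>\<bar>d\<bar> \<le> 2\<^sup>-\<^sup>k + 2\<^sup>k \<bar>d\<bar>\<^sup>2\<close>. Fatou's lemma then identifies the pointwise limit as the limit in
  the mean.
\<close>

instance l2 :: (euclidean_space) complete_space
proof
  fix X :: "nat \<Rightarrow> 'a l2" assume "Cauchy X"
  have "\<exists>N. \<forall>m\<ge>N. \<forall>n\<ge>N. dist (X m) (X n) < (1/2)^k" for k :: nat
    using \<open>Cauchy X\<close> by (auto simp: Cauchy_def)
  then obtain N where N: "\<And>k m n. N k \<le> m \<Longrightarrow> N k \<le> n \<Longrightarrow> dist (X m) (X n) < (1/2)^k"
    by metis
  define r where "r k = (\<Sum>i\<le>k. N i) + k" for k
  have r_mono: "strict_mono r"
    by (rule strict_monoI_Suc) (simp add: r_def)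
  have r_ge: "N k \<le> r m" if "k \<le> m" for k m
    using member_le_sum[of k "{..m}" N] that by (simp add: r_def)
  have fast: "norm (X (r m) - X (r k)) \<le> (1/2)^k" if "k \<le> m" for k m
    using N[OF r_ge[OF that] r_ge[of k k]] by (simp add: dist_norm)
  have "\<forall>k. \<exists>f. square_integrable f \<and> X (r k) = abs_l2 f"
    using l2_cases by metis
  then obtain f where f: "\<And>k. square_integrable (f k)" and Xf: "\<And>k. X (r k) = abs_l2 (f k)"
    by metis
  have [measurable]: "f k \<in> borel_measurable borel" for k
    using f[of k] by (simp add: square_integrable_def)
  have sq: "integrable lborel (\<lambda>x. (cmod (f m x - f k x))\<^sup>2)" for m k
    using square_integrable_diff[OF f f] by (simp add: square_integrable_def)
  have near: "(\<integral>x. (cmod (f m x - f k x))\<^sup>2 \<partial>lborel) \<le> (1/4)^k" if "k \<le> m" for k m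
  proof -
    have "(\<integral>x. (cmod (f m x - f k x))\<^sup>2 \<partial>lborel) = (norm (X (r m) - X (r k)))\<^sup>2"
      unfolding Xf by (simp add: diff_abs_l2 f norm_abs_l2 square_integrable_diff)
    also have "\<dots> \<le> ((1/2)^k)\<^sup>2"
      by (intro power_mono fast that) simp
    finally show ?thesis by (simp add: power_divide flip: power_mult power_mult_distrib)
        (simp add: power_mult mult.commute[of k])
  qed
  have "AE x in lborel. summable (\<lambda>k. 2^k * (cmod (f (Suc k) x - f k x))\<^sup>2)"
  proof (rule AE_summable_of_summable_integral)
    have "2^k * (\<integral>x. (cmod (f (Suc k) x - f k x))\<^sup>2 \<partial>lborel) \<le> (1/2)^k" for k
      using mult_left_mono[OF near[of k "Suc k"], of "2^k"]
      by (simp flip: power_mult_distrib)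
    then show "summable (\<lambda>k. \<integral>x. 2^k * (cmod (f (Suc k) x - f k x))\<^sup>2 \<partial>lborel)"
      by (intro summable_comparison_test'[OF summable_geometric[of "1/2::real"], of 0]) auto
  qed (auto intro!: sq)
  then have conv: "AE x in lborel. convergent (\<lambda>k. f k x)"
  proof eventually_elim
    case (elim x)
    have bound: "d \<le> (1/2)^k + 2^k * d\<^sup>2" if "d \<ge> 0" for d :: real and k :: nat
    proof -
      have "0 \<le> 2^k * (d - (1/2)^k)\<^sup>2"
        by simp
      also have "2^k * (d - (1/2)^k)\<^sup>2 = 2^k * d\<^sup>2 - 2 * d + (1/2)^k"
        by (simp add: power2_eq_square algebra_simps power_divide)
      finally show ?thesis using that by linarith
    qed
    have "summable (\<lambda>k. (1/2)^k + 2^k * (cmod (f (Suc k) x - f k x))\<^sup>2)"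
      by (intro summable_add elim summable_geometric) simp
    then have "summable (\<lambda>k. cmod (f (Suc k) x - f k x))"
      by (rule summable_comparison_test') (use bound in simp)
    then show ?case by (rule convergent_of_summable_diff)
  qed
  define F where "F x = lim (\<lambda>k. f k x)" for x
  have [measurable]: "F \<in> borel_measurable borel"
    unfolding F_def by measurable
  have lim: "AE x in lborel. (\<lambda>k. f k x) \<longlonglongrightarrow> F x"
    using conv by eventually_elim (simp add: F_def convergent_LIMSEQ_iff)
  have fatou: "(\<integral>\<^sup>+x. ennreal ((cmod (F x - f k x))\<^sup>2) \<partial>lborel) \<le> ennreal ((1/4)^k)" for k
  proof -
    have "(\<integral>\<^sup>+x. ennreal ((cmod (F x - f k x))\<^sup>2) \<partial>lborel)
        = (\<integral>\<^sup>+x. liminf (\<lambda>m. ennreal ((cmod (f m x - f k x))\<^sup>2)) \<partial>lborel)"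
      using lim
    proof (intro nn_integral_cong_AE, eventually_elim)
      case (elim x)
      have "(\<lambda>m. ennreal ((cmod (f m x - f k x))\<^sup>2)) \<longlonglongrightarrow> ennreal ((cmod (F x - f k x))\<^sup>2)"
        by (intro tendsto_intros tendsto_ennrealI elim)
      then show ?case by (intro lim_imp_Liminf[symmetric]) simp_all
    qed
    also have "\<dots> \<le> liminf (\<lambda>m. \<integral>\<^sup>+x. ennreal ((cmod (f m x - f k x))\<^sup>2) \<partial>lborel)"
      by (rule nn_integral_liminf) auto
    also have "\<dots> \<le> ennreal ((1/4)^k)"
    proof (rule Liminf_le[OF sequentially_bot], rule eventually_sequentiallyI[of k])
      fix m assume "k \<le> m"
      show "(\<integral>\<^sup>+x. ennreal ((cmod (f m x - f k x))\<^sup>2) \<partial>lborel) \<le> ennreal ((1/4)^k)"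
        using near[OF \<open>k \<le> m\<close>] sq by (simp add: nn_integral_eq_integral ennreal_leI)
    qed
    finally show ?thesis .
  qed
  have diff: "square_integrable (\<lambda>x. F x - f k x)" for k
    unfolding square_integrable_def
    using le_less_trans[OF fatou[of k] ennreal_less_top] by (auto simp: integrable_iff_bounded)
  have F: "square_integrable F"
    using square_integrable_add[OF diff[of 0] f[of 0]] by simp
  have bound: "norm (X (r k) - abs_l2 F) \<le> (1/2)^k" for k
  proof -
    have "(\<integral>x. (cmod (F x - f k x))\<^sup>2 \<partial>lborel) \<le> (1/4)^k"
      using diff[of k] fatou[of k]
      by (subst (asm) nn_integral_eq_integral) (auto simp: square_integrable_def)
    then have "(norm (abs_l2 F - X (r k)))\<^sup>2 \<le> ((1/2)^k)\<^sup>2"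
      unfolding Xf
      by (simp add: diff_abs_l2 f F norm_abs_l2 diff power_divide flip: power_mult)
         (simp add: power_mult mult.commute[of k])
    then have "norm (abs_l2 F - X (r k)) \<le> (1/2)^k"
      by (rule power2_le_imp_le) simp
    then show ?thesis
      by (subst norm_minus_commute)
  qed
  have "(\<lambda>k. X (r k)) \<longlonglongrightarrow> abs_l2 F"
    unfolding LIM_zero_iff[symmetric, of _ "abs_l2 F"]
    by (rule Lim_null_comparison[of _ "\<lambda>k. (1/2)^k"]) (auto intro!: always_eventually bound LIMSEQ_realpow_zero)
  then show "convergent X"
    using Cauchy_converges_subseq[OF \<open>Cauchy X\<close> r_mono]
    by (auto simp: convergent_def comp_def)
qed


section \<open>The complex inner product and adjoints\<close>

lemma cinner_add_left: "cinner_l2 (a + b) c = cinner_l2 a c + cinner_l2 b c"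
  by transfer (simp add: l2rel_def distrib_right square_integrable_mult)

lemma cinner_add_right: "cinner_l2 a (b + c) = cinner_l2 a b + cinner_l2 a c"
  by transfer (simp add: l2rel_def distrib_left square_integrable_mult)

lemma cinner_scaleC_left: "cinner_l2 (scaleC_l2 c a) b = c * cinner_l2 a b"
  by transfer (simp add: mult.assoc)

lemma cinner_commute: "cinner_l2 a b = cnj (cinner_l2 b a)"
  by transfer (simp add: mult.commute flip: Bochner_Integration.integral_cnj)

lemma cinner_scaleC_right: "cinner_l2 a (scaleC_l2 c b) = cnj c * cinner_l2 a b"
  by (subst (1 2) cinner_commute) (simp add: cinner_scaleC_left)

lemma scaleR_eq_scaleC: "r *\<^sub>R a = scaleC_l2 (complex_of_real r) a"
  by (simp add: scaleR_l2_def)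

lemma scaleC_l2_one: "scaleC_l2 1 \<phi> = \<phi>"
  using scaleR_eq_scaleC[of 1 \<phi>] by simp

lemma scaleC_l2_zero: "scaleC_l2 0 \<phi> = 0"
  using scaleR_eq_scaleC[of 0 \<phi>] by simp

lemma minus_eq_scaleC: "- a = scaleC_l2 (- 1) (a :: 'a::euclidean_space l2)"
  by (simp add: uminus_l2_def)

lemma cinner_diff_left: "cinner_l2 (a - b) c = cinner_l2 a c - cinner_l2 b c"
  by (simp only: diff_conv_add_uminus cinner_add_left minus_eq_scaleC cinner_scaleC_left) simp

lemma cinner_diff_right: "cinner_l2 a (b - c) = cinner_l2 a b - cinner_l2 a c"
  by (simp only: diff_conv_add_uminus cinner_add_right minus_eq_scaleC cinner_scaleC_right) simp

lemma cinner_scaleR_left: "cinner_l2 (r *\<^sub>R a) b = r *\<^sub>R cinner_l2 a b"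
  by (simp add: scaleR_eq_scaleC cinner_scaleC_left scaleR_conv_of_real)

lemma cinner_scaleR_right: "cinner_l2 a (r *\<^sub>R b) = r *\<^sub>R cinner_l2 a b"
  by (simp add: scaleR_eq_scaleC cinner_scaleC_right scaleR_conv_of_real)

lemma cinner_zero_right [simp]: "cinner_l2 a 0 = 0"
  using cinner_diff_right[of a 0 0] by simp

lemma cinner_self: "cinner_l2 a a = complex_of_real ((norm a)\<^sup>2)"
proof -
  have "Im (cinner_l2 a a) = 0"
    using arg_cong[OF cinner_commute[of a a], of Im] by simp
  then show ?thesis
    by (simp add: complex_eq_iff power2_norm_eq_inner inner_l2_def)
qed

lemma cinner_eq_inner: "cinner_l2 a b = Complex (inner a b) (inner a (scaleC_l2 \<i> b))"
  by (simp add: complex_eq_iff inner_l2_def cinner_scaleC_right)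

lemma cinner_left_eqI:
  assumes "\<And>\<psi>. cinner_l2 a \<psi> = cinner_l2 b \<psi>"
  shows "a = b"
proof -
  have "cinner_l2 (a - b) (a - b) = 0"
    unfolding cinner_diff_left assms by simp
  then show ?thesis by (simp add: cinner_self)
qed

lemma cinner_right_eqI:
  assumes "\<And>\<phi>. cinner_l2 \<phi> a = cinner_l2 \<phi> b"
  shows "a = b"
proof (rule cinner_left_eqI)
  show "cinner_l2 a \<psi> = cinner_l2 b \<psi>" for \<psi>
    using assms[of \<psi>] cinner_commute[of a \<psi>] cinner_commute[of b \<psi>] by simp
qed

lemma norm_scaleC_l2: "norm (scaleC_l2 c a) = cmod c * norm a"
proof -
  have "complex_of_real ((norm (scaleC_l2 c a))\<^sup>2) = (c * cnj c) * cinner_l2 a a"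
    unfolding cinner_self[symmetric] by (simp add: cinner_scaleC_left cinner_scaleC_right)
  also have "\<dots> = complex_of_real ((cmod c * norm a)\<^sup>2)"
    by (simp only: cinner_self complex_norm_square[symmetric] power_mult_distrib of_real_mult)
  finally have "complex_of_real ((norm (scaleC_l2 c a))\<^sup>2) = complex_of_real ((cmod c * norm a)\<^sup>2)" .
  then show ?thesis
    by (simp only: of_real_eq_iff power2_eq_iff_nonneg norm_ge_zero mult_nonneg_nonneg)
qed

lemma cmod_cinner_le: "cmod (cinner_l2 a b) \<le> norm a * norm b"
proof (cases "cinner_l2 a b = 0")
  case False
  define c where "c = cnj (sgn (cinner_l2 a b))"
  have c: "cmod c = 1"
    using False by (simp add: c_def norm_sgn)
  have "c * cinner_l2 a b = complex_of_real (cmod (cinner_l2 a b))"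
    using False by (simp add: c_def sgn_eq complex_norm_square[symmetric] power2_eq_square mult.commute)
  then have "cmod (cinner_l2 a b) = inner (scaleC_l2 c a) b"
    by (simp add: inner_l2_def cinner_scaleC_left)
  also have "\<dots> \<le> norm (scaleC_l2 c a) * norm b"
    by (rule norm_cauchy_schwarz)
  finally show ?thesis
    by (simp add: norm_scaleC_l2 c)
qed simp

lemma bounded_linear_cinner_left: "bounded_linear (\<lambda>a. cinner_l2 a b)"
  by (rule bounded_linear_intro[where K = "norm b"])
     (simp_all add: cinner_add_left cinner_scaleR_left cmod_cinner_le)

lemma bounded_linear_cinner_right: "bounded_linear (\<lambda>b. cinner_l2 a b)"
  by (rule bounded_linear_intro[where K = "norm a"])
     (simp_all add: cinner_add_right cinner_scaleR_right cmod_cinner_le mult.commute[of _ "norm a"])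

lemma complex_riesz_representation:
  fixes G :: "'a::euclidean_space l2 \<Rightarrow> complex"
  assumes "bounded_linear G" and scaleC: "\<And>c \<phi>. G (scaleC_l2 c \<phi>) = c * G \<phi>"
  shows "\<exists>w. \<forall>\<phi>. G \<phi> = cinner_l2 \<phi> w"
proof -
  have "bounded_linear (\<lambda>\<phi>. Re (G \<phi>))"
    by (rule bounded_linear_compose[OF bounded_linear_Re assms(1)])
  then obtain w where w: "\<And>\<phi>. Re (G \<phi>) = inner w \<phi>"
    using riesz_representation by blast
  have Re_G: "Re (G \<phi>) = Re (cinner_l2 \<phi> w)" for \<phi>
    using w[of \<phi>] inner_commute[of w \<phi>] by (simp add: inner_l2_def)
  \<comment> \<open>The imaginary part is recovered from the real part at \<open>\<i> \<phi>\<close>.\<close>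
  have "Im (G \<phi>) = Im (cinner_l2 \<phi> w)" for \<phi>
    using Re_G[of "scaleC_l2 \<i> \<phi>"] by (simp add: scaleC cinner_scaleC_left)
  then show ?thesis
    using Re_G by (auto simp: complex_eq_iff)
qed

lemma bounded_ops_scaleC:
  "A \<in> bounded_ops \<Longrightarrow> blinfun_apply A (scaleC_l2 c \<phi>) = scaleC_l2 c (blinfun_apply A \<phi>)"
  by (simp add: bounded_ops_def)

lemma bounded_op_eqI:
  assumes "\<And>\<phi> \<psi>. cinner_l2 (blinfun_apply A \<phi>) \<psi> = cinner_l2 (blinfun_apply B \<phi>) \<psi>"
  shows "A = B"
  using assms by (intro blinfun_eqI cinner_left_eqI)

text \<open>
  The adjoint is a definite description, so its existence has to be derived from the Riesz
  theorem before anything can be said about it.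
\<close>

lemma adjoint_exists:
  fixes A :: "'a::euclidean_space l2_op"
  assumes "A \<in> bounded_ops"
  shows "\<exists>B\<in>bounded_ops. norm B \<le> norm A \<and>
    (\<forall>\<phi> \<psi>. cinner_l2 (blinfun_apply A \<phi>) \<psi> = cinner_l2 \<phi> (blinfun_apply B \<psi>))"
proof -
  have "\<exists>w. \<forall>\<phi>. cinner_l2 (blinfun_apply A \<phi>) \<psi> = cinner_l2 \<phi> w" for \<psi>
    using assms
    by (intro complex_riesz_representation
          bounded_linear_compose[OF bounded_linear_cinner_left blinfun.bounded_linear_right])
       (simp add: bounded_ops_scaleC cinner_scaleC_left)
  then obtain B where B: "\<And>\<phi> \<psi>. cinner_l2 (blinfun_apply A \<phi>) \<psi> = cinner_l2 \<phi> (B \<psi>)"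
    by metis
  have scaleC: "B (scaleC_l2 c \<psi>) = scaleC_l2 c (B \<psi>)" for c \<psi>
    by (rule cinner_right_eqI) (simp add: cinner_scaleC_right flip: B)
  have bound: "norm (B \<psi>) \<le> norm A * norm \<psi>" for \<psi>
  proof -
    have "complex_of_real ((norm (B \<psi>))\<^sup>2) = cinner_l2 (blinfun_apply A (B \<psi>)) \<psi>"
      by (simp only: B cinner_self)
    then have "(norm (B \<psi>))\<^sup>2 = cmod (cinner_l2 (blinfun_apply A (B \<psi>)) \<psi>)"
      by (metis norm_of_real abs_power2)
    also have "\<dots> \<le> norm (blinfun_apply A (B \<psi>)) * norm \<psi>"
      by (rule cmod_cinner_le)
    also have "\<dots> \<le> norm A * norm (B \<psi>) * norm \<psi>"
      by (intro mult_right_mono norm_blinfun) simp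
    finally show ?thesis
      by (cases "norm (B \<psi>) = 0") (simp_all add: power2_eq_square mult.commute mult.left_commute)
  qed
  have "bounded_linear B"
  proof (rule bounded_linear_intro[where K = "norm A"])
    show "B (\<phi> + \<psi>) = B \<phi> + B \<psi>" for \<phi> \<psi>
      by (rule cinner_right_eqI) (simp add: cinner_add_right flip: B)
    show "B (r *\<^sub>R \<psi>) = r *\<^sub>R B \<psi>" for r \<psi>
      by (simp add: scaleR_eq_scaleC scaleC)
    show "norm (B \<psi>) \<le> norm \<psi> * norm A" for \<psi>
      using bound by (simp add: mult.commute)
  qed
  then have apply_B: "blinfun_apply (Blinfun B) = B"
    by (rule bounded_linear_Blinfun_apply)
  have "norm (Blinfun B) \<le> norm A"
    by (rule norm_blinfun_bound) (simp_all add: apply_B bound)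
  then show ?thesis
    using B scaleC by (intro bexI[of _ "Blinfun B"]) (auto simp: bounded_ops_def apply_B)
qed

lemma op_adjoint_eqI:
  assumes "B \<in> bounded_ops"
    and "\<And>\<phi> \<psi>. cinner_l2 (blinfun_apply A \<phi>) \<psi> = cinner_l2 \<phi> (blinfun_apply B \<psi>)"
  shows "op_adjoint A = B"
  unfolding op_adjoint_def
proof (rule the_equality)
  fix C assume "C \<in> bounded_ops \<and>
    (\<forall>\<phi> \<psi>. cinner_l2 (blinfun_apply A \<phi>) \<psi> = cinner_l2 \<phi> (blinfun_apply C \<psi>))"
  then show "C = B"
    using assms by (intro blinfun_eqI cinner_right_eqI) metis
qed (use assms in blast)

lemma cinner_op_adjoint:
  assumes "A \<in> bounded_ops"
  shows "cinner_l2 (blinfun_apply A \<phi>) \<psi> = cinner_l2 \<phi> (blinfun_apply (op_adjoint A) \<psi>)"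
  using adjoint_exists[OF assms] op_adjoint_eqI by metis

lemma norm_op_adjoint_le:
  assumes "A \<in> bounded_ops"
  shows "norm (op_adjoint A) \<le> norm A"
  using adjoint_exists[OF assms] op_adjoint_eqI by metis


section \<open>Injectivity of the Fourier transform\<close>

lemma integral_iexp_distr_density:
  fixes X :: "'a \<Rightarrow> real" and g :: "'a \<Rightarrow> real"
  assumes [measurable]: "X \<in> borel_measurable M" and g: "integrable M g" "\<And>\<omega>. 0 \<le> g \<omega>"
    and one: "(\<integral>\<omega>. g \<omega> \<partial>M) = 1"
  defines "N \<equiv> distr (density M (\<lambda>\<omega>. ennreal (g \<omega>))) borel X"
  shows "real_distribution N" "char N t = (\<integral>\<omega>. g \<omega> *\<^sub>R iexp (t * X \<omega>) \<partial>M)"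
    "B \<in> sets borel \<Longrightarrow> measure N B = (\<integral>\<omega>. g \<omega> * indicator B (X \<omega>) \<partial>M)"
proof -
  have [measurable]: "g \<in> borel_measurable M"
    using g by auto
  have "emeasure (density M (\<lambda>\<omega>. ennreal (g \<omega>))) (space M) = (\<integral>\<^sup>+\<omega>. ennreal (g \<omega>) \<partial>M)"
    by (subst emeasure_density) (auto intro!: nn_integral_cong)
  also have "\<dots> = 1"
    using g one by (simp add: nn_integral_eq_integral)
  finally interpret D: prob_space "density M (\<lambda>\<omega>. ennreal (g \<omega>))"
    by (intro prob_spaceI) simp
  interpret N: prob_space N
    unfolding N_def by (rule D.prob_space_distr) simp
  show "real_distribution N"
    by unfold_locales (simp_all add: N_def)
  show "char N t = (\<integral>\<omega>. g \<omega> *\<^sub>R iexp (t * X \<omega>) \<partial>M)"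
    unfolding char_def N_def using g
    by (subst integral_distr) (auto intro!: integral_density)
  assume [measurable]: "B \<in> sets borel"
  have "measure N B = (\<integral>x. indicator B x \<partial>N)"
    by (simp add: N_def)
  also have "\<dots> = (\<integral>\<omega>. indicator B (X \<omega>) \<partial>density M (\<lambda>\<omega>. ennreal (g \<omega>)))"
    unfolding N_def by (rule integral_distr) auto
  also have "\<dots> = (\<integral>\<omega>. g \<omega> * indicator B (X \<omega>) \<partial>M)"
    using g by (subst integral_density) auto
  finally show "measure N B = (\<integral>\<omega>. g \<omega> * indicator B (X \<omega>) \<partial>M)" .
qed

text \<open>
  Split \<open>h\<close> into its positive and negative parts. They have the same integral, and after
  normalization their images under \<open>X\<close> are two probability measures with the same
  characteristic function, so Levy's uniqueness theorem identifies them.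
\<close>

lemma real_fourier_transform_zero:
  fixes X :: "'a \<Rightarrow> real" and h :: "'a \<Rightarrow> real"
  assumes [measurable]: "X \<in> borel_measurable M" "B \<in> sets borel" and h: "integrable M h"
    and zero: "\<And>t. (\<integral>\<omega>. h \<omega> *\<^sub>R iexp (t * X \<omega>) \<partial>M) = 0"
  shows "(\<integral>\<omega>. h \<omega> * indicator B (X \<omega>) \<partial>M) = 0"
proof -
  have [measurable]: "h \<in> borel_measurable M"
    using h by auto
  define hp hm where "hp \<omega> = max 0 (h \<omega>)" and "hm \<omega> = max 0 (- h \<omega>)" for \<omega>
  have h_eq: "h \<omega> = hp \<omega> - hm \<omega>" for \<omega>
    by (simp add: hp_def hm_def)
  have hp: "integrable M hp" "\<And>\<omega>. 0 \<le> hp \<omega>" and hm: "integrable M hm" "\<And>\<omega>. 0 \<le> hm \<omega>"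
    using h by (auto simp: hp_def[abs_def] hm_def[abs_def])
  have [measurable]: "hp \<in> borel_measurable M" "hm \<in> borel_measurable M"
    using hp hm by auto
  define c where "c = (\<integral>\<omega>. hp \<omega> \<partial>M)"
  have "complex_of_real (\<integral>\<omega>. h \<omega> \<partial>M) = 0"
    using zero[of 0] by (simp add: scaleR_conv_of_real)
  then have c': "(\<integral>\<omega>. hm \<omega> \<partial>M) = c"
    using hp hm by (simp add: h_eq c_def)
  have "c \<ge> 0"
    using hp by (simp add: c_def)
  have int_B: "integrable M (\<lambda>\<omega>. g \<omega> * indicator B (X \<omega>))" if "integrable M g" for g :: "'a \<Rightarrow> real"
    by (rule integrable_real_mult_indicator[of "X -` B \<inter> space M" M g, THEN Bochner_Integration.integrable_cong[THEN iffD1, rotated -1]])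
       (auto simp: that split: split_indicator)
  have int_e: "integrable M (\<lambda>\<omega>. g \<omega> *\<^sub>R iexp (t * X \<omega>))" if "integrable M g" for g :: "'a \<Rightarrow> real" and t
    by (rule Bochner_Integration.integrable_bound[OF that]) (use that in auto)
  show ?thesis
  proof (cases "c = 0")
    case True
    then have "AE \<omega> in M. hp \<omega> = 0" "AE \<omega> in M. hm \<omega> = 0"
      using integral_nonneg_eq_0_iff_AE[OF hp(1)] integral_nonneg_eq_0_iff_AE[OF hm(1)] hp(2) hm(2) c'
      by (auto simp: c_def)
    then have "AE \<omega> in M. h \<omega> * indicator B (X \<omega>) = 0"
      by eventually_elim (simp add: h_eq)
    then show ?thesis
      by (rule integral_eq_zero_AE)
  next
    case False
    let ?P = "\<lambda>g. distr (density M (\<lambda>\<omega>. ennreal (g \<omega> / c))) borel X"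
    have unit: "integrable M (\<lambda>\<omega>. g \<omega> / c)" "0 \<le> g \<omega> / c" "(\<integral>\<omega>. g \<omega> / c \<partial>M) = 1"
      if "g = hp \<or> g = hm" for g \<omega>
      using that hp hm False \<open>c \<ge> 0\<close> c' c_def by auto
    note P = integral_iexp_distr_density[OF assms(1) unit[OF disjI1[OF refl]]]
    note Q = integral_iexp_distr_density[OF assms(1) unit[OF disjI2[OF refl]]]
    have "?P hp = ?P hm"
    proof (rule Levy_uniqueness)
      show "real_distribution (?P hp)" "real_distribution (?P hm)"
        by (fact P(1) Q(1))+
      show "char (?P hp) = char (?P hm)"
      proof
        fix t
        have "char (?P hp) t = (\<integral>\<omega>. (hp \<omega> / c) *\<^sub>R iexp (t * X \<omega>) \<partial>M)"
          by (fact P(2))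
        also have "\<dots> = (\<integral>\<omega>. (hm \<omega> / c) *\<^sub>R iexp (t * X \<omega>)
            + (1 / c) *\<^sub>R (h \<omega> *\<^sub>R iexp (t * X \<omega>)) \<partial>M)"
        proof (intro Bochner_Integration.integral_cong refl)
          fix \<omega>
          have "hp \<omega> / c = hm \<omega> / c + (1 / c) * h \<omega>"
            by (simp add: h_eq diff_divide_distrib)
          then show "(hp \<omega> / c) *\<^sub>R iexp (t * X \<omega>) = (hm \<omega> / c) *\<^sub>R iexp (t * X \<omega>)
              + (1 / c) *\<^sub>R (h \<omega> *\<^sub>R iexp (t * X \<omega>))"
            by (simp only: scaleR_add_left scaleR_scaleR)
        qed
        also have "\<dots> = (\<integral>\<omega>. (hm \<omega> / c) *\<^sub>R iexp (t * X \<omega>) \<partial>M)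
          + (\<integral>\<omega>. (1 / c) *\<^sub>R (h \<omega> *\<^sub>R iexp (t * X \<omega>)) \<partial>M)"
          by (intro Bochner_Integration.integral_add integrable_scaleR_right int_e unit h) simp
        also have "\<dots> = char (?P hm) t"
          by (simp only: zero Q(2) integral_scaleR_right scaleR_zero_right add_0_right)
        finally show "char (?P hp) t = char (?P hm) t" .
      qed
    qed
    then have "(\<integral>\<omega>. hp \<omega> / c * indicator B (X \<omega>) \<partial>M) = (\<integral>\<omega>. hm \<omega> / c * indicator B (X \<omega>) \<partial>M)"
      by (simp only: P(3)[OF assms(2), symmetric] Q(3)[OF assms(2), symmetric])
    then have "(\<integral>\<omega>. hp \<omega> * indicator B (X \<omega>) \<partial>M) = (\<integral>\<omega>. hm \<omega> * indicator B (X \<omega>) \<partial>M)"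
      using False by simp
    then show ?thesis
      using int_B[OF hp(1)] int_B[OF hm(1)] by (simp add: h_eq left_diff_distrib)
  qed
qed

lemma fourier_transform_zero:
  fixes X :: "'a \<Rightarrow> real" and H :: "'a \<Rightarrow> complex"
  assumes [measurable]: "X \<in> borel_measurable M" "B \<in> sets borel" and H: "integrable M H"
    and zero: "\<And>t. (\<integral>\<omega>. H \<omega> * iexp (t * X \<omega>) \<partial>M) = 0"
  shows "(\<integral>\<omega>. H \<omega> * indicator B (X \<omega>) \<partial>M) = 0"
proof -
  have [measurable]: "H \<in> borel_measurable M"
    using H by auto
  have int: "integrable M (\<lambda>\<omega>. H \<omega> * iexp (t * X \<omega>))" for t
    by (rule Bochner_Integration.integrable_bound[OF H]) (auto simp: norm_mult)
  have int': "integrable M (\<lambda>\<omega>. cnj (H \<omega>) * iexp (t * X \<omega>))" for t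
    by (rule Bochner_Integration.integrable_bound[OF H]) (auto simp: norm_mult)
  \<comment> \<open>Conjugation turns the frequency \<open>t\<close> into \<open>- t\<close>.\<close>
  have zero': "(\<integral>\<omega>. cnj (H \<omega>) * iexp (t * X \<omega>) \<partial>M) = 0" for t
    using arg_cong[OF zero[of "- t"], of cnj]
    by (simp add: exp_cnj flip: Bochner_Integration.integral_cnj)
  have part: "(\<integral>\<omega>. Re (a * H \<omega>) * indicator B (X \<omega>) \<partial>M) = 0" for a
  proof (rule real_fourier_transform_zero)
    show "integrable M (\<lambda>\<omega>. Re (a * H \<omega>))"
      using H by (intro integrable_Re integrable_mult_right)
    fix t
    have "Re (a * H \<omega>) *\<^sub>R iexp (t * X \<omega>) =
        (a / 2) * (H \<omega> * iexp (t * X \<omega>)) + (cnj a / 2) * (cnj (H \<omega>) * iexp (t * X \<omega>))" for \<omega>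
    proof -
      have "complex_of_real (Re (a * H \<omega>)) = (a * H \<omega> + cnj (a * H \<omega>)) / 2"
        by (simp only: complex_add_cnj) simp
      then show ?thesis
        by (simp add: scaleR_conv_of_real algebra_simps add_divide_distrib)
    qed
    then show "(\<integral>\<omega>. Re (a * H \<omega>) *\<^sub>R iexp (t * X \<omega>) \<partial>M) = 0"
      using int int' by (simp add: zero zero' del: of_real_mult)
  qed simp_all
  have int_B: "integrable M (\<lambda>\<omega>. H \<omega> * indicator B (X \<omega>))"
    by (rule Bochner_Integration.integrable_bound[OF H]) (auto simp: norm_mult split: split_indicator)
  have Re: "Re (z * indicator B x) = Re (1 * z) * indicator B x"
    and Im: "Im (z * indicator B x) = Re (- \<i> * z) * indicator B x" for z x
    by (simp_all split: split_indicator)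
  show ?thesis
    using part[of 1] part[of "- \<i>"] int_B
    by (simp only: complex_eq_iff integral_Re[symmetric] integral_Im[symmetric] Re Im) simp
qed

text \<open>
  Integrating \<open>H\<close> over the set where \<open>Re (a H) > 0\<close> shows that this set is null; the four units
  \<open>a = 1, -1, \<i>, -\<i>\<close> then leave only \<open>H = 0\<close>.
\<close>

lemma AE_zero_of_set_integrals_zero:
  fixes H :: "'a \<Rightarrow> complex"
  assumes H: "integrable M H"
    and zero: "\<And>A. A \<in> sets M \<Longrightarrow> (\<integral>x. H x * indicator A x \<partial>M) = 0"
  shows "AE x in M. H x = 0"
proof -
  have [measurable]: "H \<in> borel_measurable M"
    using H by auto
  have part: "AE x in M. Re (a * H x) \<le> 0" for a
  proof -
    let ?A = "{x \<in> space M. 0 < Re (a * H x)}"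
    have "(\<integral>x. max 0 (Re (a * H x)) \<partial>M) = (\<integral>x. Re (a * (H x * indicator ?A x)) \<partial>M)"
      by (intro Bochner_Integration.integral_cong) (auto split: split_indicator)
    also have "\<dots> = Re (a * (\<integral>x. H x * indicator ?A x \<partial>M))"
      using H by (subst integral_Re)
        (auto intro!: integrable_mult_right Bochner_Integration.integrable_bound[OF H]
          simp: norm_mult split: split_indicator)
    also have "\<dots> = 0"
      by (subst zero) auto
    finally have "AE x in M. max 0 (Re (a * H x)) = 0"
      using H by (subst (asm) integral_nonneg_eq_0_iff_AE) auto
    then show ?thesis
      by eventually_elim (simp add: max_def split: if_splits)
  qed
  show ?thesis
    using part[of 1] part[of "-1"] part[of \<i>] part[of "- \<i>"]
    by eventually_elim (simp add: complex_eq_iff)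
qed

text \<open>
  The one-dimensional result, applied to one coordinate after the other, replaces the
  exponentials by indicator functions of boxes, and boxes generate the Borel sets.
\<close>

lemma fourier_transform_injective:
  fixes F :: "'a::euclidean_space \<Rightarrow> complex"
  assumes F: "integrable lborel F"
    and zero: "\<And>v. (\<integral>x. F x * iexp (inner v x) \<partial>lborel) = 0"
  shows "AE x in lborel. F x = 0"
proof -
  have [measurable]: "F \<in> borel_measurable borel"
    using F by auto
  have bounded_mult: "integrable lborel (\<lambda>x. F x * m x)"
    if "m \<in> borel_measurable borel" "\<And>x. cmod (m x) \<le> 1" for m
    by (rule Bochner_Integration.integrable_bound[OF F]) (use that in \<open>auto simp: norm_mult mult_left_le\<close>)
  have boxes: "(\<integral>x. F x * indicator {x. \<forall>b\<in>S. x \<bullet> b \<in> B b} x * iexp (inner v x) \<partial>lborel) = 0"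
    if "finite S" "\<And>b. B b \<in> sets borel" for S B v
    using that(1)
  proof (induction S arbitrary: v rule: finite_induct)
    case empty
    then show ?case using zero by simp
  next
    case (insert a S)
    note [measurable] = that(2) and [simp] = \<open>finite S\<close>
    let ?H = "\<lambda>x. F x * indicator {x. \<forall>b\<in>S. x \<bullet> b \<in> B b} x * iexp (inner v x)"
    have [measurable]: "{x :: 'a. \<forall>b\<in>S. x \<bullet> b \<in> B b} \<in> sets borel"
      by measurable
    have "(\<integral>x. ?H x * indicator (B a) (x \<bullet> a) \<partial>lborel) = 0"
    proof (rule fourier_transform_zero)
      show "integrable lborel ?H"
        unfolding mult.assoc by (rule bounded_mult) (auto simp: norm_mult split: split_indicator)
      fix t
      have "(\<integral>x. ?H x * iexp (t * (x \<bullet> a)) \<partial>lborel)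
          = (\<integral>x. F x * indicator {x. \<forall>b\<in>S. x \<bullet> b \<in> B b} x * iexp (inner (v + t *\<^sub>R a) x) \<partial>lborel)"
        by (simp add: inner_add_left inner_commute[of _ a] distrib_left exp_add mult.assoc)
      then show "(\<integral>x. ?H x * iexp (t * (x \<bullet> a)) \<partial>lborel) = 0"
        by (simp add: insert.IH)
    qed simp_all
    moreover have "(\<lambda>x. ?H x * indicator (B a) (x \<bullet> a))
        = (\<lambda>x. F x * indicator {x. \<forall>b\<in>insert a S. x \<bullet> b \<in> B b} x * iexp (inner v x))"
      by (auto split: split_indicator)
    ultimately show ?case by simp
  qed
  have int: "integrable lborel (\<lambda>x. F x * indicator A x)" if "A \<in> sets borel" for A
    by (rule bounded_mult) (use that in \<open>auto split: split_indicator\<close>)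
  have "(\<integral>x. F x * indicator A x \<partial>lborel) = 0" if "A \<in> sets borel" for A
  proof -
    let ?E = "range (\<lambda>(a, b). box a b :: 'a set)"
    have sets: "sigma_sets UNIV ?E = sets borel"
      by (simp add: borel_eq_box)
    have "Int_stable ?E" "?E \<subseteq> Pow UNIV" "A \<in> sigma_sets UNIV ?E"
      using that by (auto simp: Int_stable_def box_Int_box sets)
    then show ?thesis
    proof (induction rule: sigma_sets_induct_disjoint)
      case (basic A)
      then obtain l u where A: "A = box l u" by auto
      have "A = {x. \<forall>b\<in>Basis. x \<bullet> b \<in> {l \<bullet> b <..< u \<bullet> b}}"
        by (auto simp: A box_def)
      then show ?case
        using boxes[of Basis "\<lambda>b. {l \<bullet> b <..< u \<bullet> b}" 0] by simp
    next
      case empty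
      then show ?case by simp
    next
      case (compl A)
      then have "A \<in> sets borel" by (simp add: sets)
      have "(\<integral>x. F x * indicator (UNIV - A) x \<partial>lborel) = (\<integral>x. F x - F x * indicator A x \<partial>lborel)"
        by (intro Bochner_Integration.integral_cong) (auto split: split_indicator)
      then show ?case
        using zero[of 0] compl F int[OF \<open>A \<in> sets borel\<close>] by simp
    next
      case (union A)
      then have A: "A i \<in> sets borel" for i by (auto simp: sets)
      have "set_integrable lborel (\<Union>i. A i) F"
        unfolding set_integrable_def using int[of "\<Union>i. A i"] A
        by (simp add: scaleR_conv_of_real of_real_indicator mult.commute)
      then have "(LINT x:(\<Union>i. A i)|lborel. F x) = (\<Sum>i. LINT x:A i|lborel. F x)"
        using A union(1) by (intro lebesgue_integral_countable_add) (auto simp: disjoint_family_on_def)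
      then show ?case
        using union(3) unfolding set_lebesgue_integral_def
        by (simp add: scaleR_conv_of_real of_real_indicator mult.commute)
    qed
  qed
  then show ?thesis
    using F by (intro AE_zero_of_set_integrals_zero) auto
qed

section \<open>Irreducibility of the Schroedinger representation\<close>

lemma schroedinger_abs_l2:
  "square_integrable f \<Longrightarrow> blinfun_apply (schroedinger l p) (abs_l2 f) = abs_l2 (schroedinger_fun l p f)"
  by (simp add: schroedinger.rep_eq schroedinger_l2.abs_eq l2rel_def)

lemma nn_integral_square_abs_l2:
  "square_integrable f \<Longrightarrow> (\<integral>\<^sup>+x. ennreal ((cmod (f x))\<^sup>2) \<partial>lborel) = ennreal ((norm (abs_l2 f))\<^sup>2)"
  by (simp add: norm_abs_l2 nn_integral_eq_integral square_integrable_def)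

text \<open>
  For \<open>z = x + i y\<close> with \<open>y\<close> fixed, the coefficient \<open>\<langle>\<pi>(z, 0) \<phi>, \<psi>\<rangle>\<close> is up to a phase the Fourier
  transform of \<open>\<xi> \<mapsto> \<phi>(\<xi> + y) \<psi>(\<xi>)\<^sup>*\<close> at \<open>\<lambda> x\<close>. If all coefficients vanish, so does this product
  for every \<open>y\<close>, and integrating its squared modulus over \<open>\<xi>\<close> and \<open>y\<close> gives \<open>\<parallel>\<phi>\<parallel>\<^sup>2 \<parallel>\<psi>\<parallel>\<^sup>2 = 0\<close>.
\<close>

lemma schroedinger_coefficients_zero:
  fixes \<phi> \<psi> :: "(real ^ 'n::finite) l2"
  assumes l: "l \<noteq> 0"
    and zero: "\<And>p. cinner_l2 (blinfun_apply (schroedinger l p) \<phi>) \<psi> = 0"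
  shows "\<phi> = 0 \<or> \<psi> = 0"
proof -
  obtain f where f: "square_integrable f" "\<phi> = abs_l2 f" by (rule l2_cases)
  obtain g where g: "square_integrable g" "\<psi> = abs_l2 g" by (rule l2_cases)
  have [measurable]: "f \<in> borel_measurable borel" "g \<in> borel_measurable borel"
    using f g by (auto simp: square_integrable_def)
  have shift: "square_integrable (\<lambda>\<xi>. f (\<xi> + y))" for y
    using square_integrable_schroedinger_fun[OF f(1), of l "(\<chi> j. \<i> * complex_of_real (y $ j), 0)"]
    by (simp add: schroedinger_fun_def[abs_def] Im_vec_def Re_vec_def Let_def vec_lambda_eta inner_vec_def)
  have ae: "AE \<xi> in lborel. f (\<xi> + y) * cnj (g \<xi>) = 0" for y
  proof (rule fourier_transform_injective)
    show "integrable lborel (\<lambda>\<xi>. f (\<xi> + y) * cnj (g \<xi>))"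
      by (rule square_integrable_mult[OF shift g(1)])
    fix v :: "real ^ 'n"
    \<comment> \<open>The group element whose coefficient is the Fourier transform at \<open>v\<close>; here \<open>\<lambda> \<noteq> 0\<close> enters.\<close>
    let ?x = "(1 / l) *\<^sub>R v"
    let ?p = "(\<chi> j. Complex (?x $ j) (y $ j), 0 :: real)"
    let ?c = "iexp (l * (inner ?x y / 2))"
    have coordinates: "Re_vec (fst ?p) = ?x" "Im_vec (fst ?p) = y"
      by (simp_all add: Re_vec_def Im_vec_def vec_eq_iff)
    have coefficient: "schroedinger_fun l ?p f \<xi> * cnj (g \<xi>) = ?c * (f (\<xi> + y) * cnj (g \<xi>) * iexp (inner v \<xi>))" for \<xi>
      unfolding schroedinger_fun_def Let_def coordinates
      using l by (simp add: distrib_left exp_add)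
    have "?c * (\<integral>\<xi>. f (\<xi> + y) * cnj (g \<xi>) * iexp (inner v \<xi>) \<partial>lborel)
        = (\<integral>\<xi>. schroedinger_fun l ?p f \<xi> * cnj (g \<xi>) \<partial>lborel)"
      by (simp only: coefficient integral_mult_right_zero)
    also have "\<dots> = 0"
      using zero[of ?p] f g
      by (simp add: schroedinger_abs_l2 cinner_abs_l2 square_integrable_schroedinger_fun)
    finally show "(\<integral>\<xi>. f (\<xi> + y) * cnj (g \<xi>) * iexp (inner v \<xi>) \<partial>lborel) = 0"
      by simp
  qed
  have "0 = (\<integral>\<^sup>+y. \<integral>\<^sup>+\<xi>. ennreal ((cmod (f (\<xi> + y)))\<^sup>2) * ennreal ((cmod (g \<xi>))\<^sup>2) \<partial>lborel \<partial>lborel)"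
  proof -
    have "(\<integral>\<^sup>+\<xi>. ennreal ((cmod (f (\<xi> + y)))\<^sup>2) * ennreal ((cmod (g \<xi>))\<^sup>2) \<partial>lborel) = 0" for y
    proof (subst nn_integral_0_iff_AE)
      show "AE \<xi> in lborel. ennreal ((cmod (f (\<xi> + y)))\<^sup>2) * ennreal ((cmod (g \<xi>))\<^sup>2) = 0"
        using ae[of y] by eventually_elim auto
    qed simp
    then show ?thesis by simp
  qed
  also have "\<dots> = (\<integral>\<^sup>+\<xi>. \<integral>\<^sup>+y. ennreal ((cmod (f (\<xi> + y)))\<^sup>2) * ennreal ((cmod (g \<xi>))\<^sup>2) \<partial>lborel \<partial>lborel)"
    by (intro lborel_pair.Fubini') measurable
  also have "\<dots> = (\<integral>\<^sup>+\<xi>. ennreal ((norm \<phi>)\<^sup>2) * ennreal ((cmod (g \<xi>))\<^sup>2) \<partial>lborel)"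
  proof (intro nn_integral_cong)
    fix \<xi> :: "real ^ 'n"
    have "(\<integral>\<^sup>+y. ennreal ((cmod (f (\<xi> + y)))\<^sup>2) \<partial>lborel)
        = (\<integral>\<^sup>+y. ennreal ((cmod (f y))\<^sup>2) \<partial>distr lborel borel (\<lambda>y. \<xi> + y))"
      by (subst nn_integral_distr) auto
    then show "(\<integral>\<^sup>+y. ennreal ((cmod (f (\<xi> + y)))\<^sup>2) * ennreal ((cmod (g \<xi>))\<^sup>2) \<partial>lborel)
        = ennreal ((norm \<phi>)\<^sup>2) * ennreal ((cmod (g \<xi>))\<^sup>2)"
      by (simp add: nn_integral_multc lborel_distr_plus nn_integral_square_abs_l2 f)
  qed
  also have "\<dots> = ennreal ((norm \<phi>)\<^sup>2) * ennreal ((norm \<psi>)\<^sup>2)"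
    by (simp add: nn_integral_cmult nn_integral_square_abs_l2 g)
  finally have "ennreal ((norm \<phi>)\<^sup>2) = 0 \<or> ennreal ((norm \<psi>)\<^sup>2) = 0"
    by (simp only: eq_commute[of 0] mult_eq_0_iff)
  then show ?thesis
    by (simp add: ennreal_eq_0_iff)
qed


section \<open>Completeness of the space of integrable functions\<close>

text \<open>
  The telescoping sums are dominated by the sum of all increments, so the sequence converges
  almost everywhere and dominated convergence applies.
\<close>

lemma L1_limit_exists:
  fixes u :: "nat \<Rightarrow> 'a \<Rightarrow> 'b::{banach, second_countable_topology}"
  assumes int: "\<And>k. integrable M (u k)"
    and sum: "summable (\<lambda>k. \<integral>x. norm (u (Suc k) x - u k x) \<partial>M)"
  shows "\<exists>g. integrable M g \<and> (\<lambda>k. \<integral>x. norm (g x - u k x) \<partial>M) \<longlonglongrightarrow> 0"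
proof -
  have [measurable]: "u k \<in> borel_measurable M" for k
    using int by auto
  define d where "d k x = norm (u (Suc k) x - u k x)" for k x
  define g where "g x = lim (\<lambda>k. u k x)" for x
  define W where "W x = norm (u 0 x) + (\<Sum>k. d k x)" for x
  have int_d: "integrable M (d k)" for k
    unfolding d_def using int by auto
  have ae: "AE x in M. summable (\<lambda>k. d k x)"
  proof (rule AE_summable_of_summable_integral[OF int_d])
    show "0 \<le> d k x" "summable (\<lambda>k. \<integral>x. d k x \<partial>M)" for k x
      using sum by (simp_all add: d_def)
  qed
  have [measurable]: "g \<in> borel_measurable M"
    unfolding g_def by measurable
  have "integrable M (\<lambda>x. \<Sum>k. d k x)"
  proof (rule integrable_suminf[OF int_d])
    show "AE x in M. summable (\<lambda>k. norm (d k x))" "summable (\<lambda>k. \<integral>x. norm (d k x) \<partial>M)"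
      using ae sum by (simp_all add: d_def)
  qed
  then have W: "integrable M W"
    unfolding W_def using int[of 0] by auto
  have lim: "AE x in M. (\<lambda>k. u k x) \<longlonglongrightarrow> g x"
    using ae
  proof eventually_elim
    case (elim x)
    then have "convergent (\<lambda>k. u k x)"
      unfolding d_def by (rule convergent_of_summable_diff)
    then show ?case
      by (simp add: g_def convergent_LIMSEQ_iff)
  qed
  have bound: "AE x in M. \<forall>k. norm (u k x) \<le> W x"
    using ae
  proof eventually_elim
    case (elim x)
    show ?case
    proof
      fix k
      have "u k x = u 0 x + (\<Sum>i<k. u (Suc i) x - u i x)"
        using sum_lessThan_telescope[of "\<lambda>i. u i x" k] by simp
      then have "norm (u k x) \<le> norm (u 0 x) + norm (\<Sum>i<k. u (Suc i) x - u i x)"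
        by (metis norm_triangle_ineq)
      also have "norm (\<Sum>i<k. u (Suc i) x - u i x) \<le> (\<Sum>i<k. d i x)"
        unfolding d_def by (rule norm_sum)
      also have "\<dots> \<le> (\<Sum>i. d i x)"
        by (rule sum_le_suminf[OF elim]) (auto simp: d_def)
      finally show "norm (u k x) \<le> W x" by (simp add: W_def)
    qed
  qed
  have g: "integrable M g"
    using W lim bound
    by (intro integrable_dominated_convergence[of g M u W]) (auto elim: eventually_mono)
  have "(\<lambda>k. \<integral>x. norm (g x - u k x) \<partial>M) \<longlonglongrightarrow> (\<integral>x. 0 \<partial>M)"
  proof (rule integral_dominated_convergence[where w = "\<lambda>x. 2 * W x"])
    show "AE x in M. (\<lambda>k. norm (g x - u k x)) \<longlonglongrightarrow> 0"
      using lim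
    proof eventually_elim
      case (elim x)
      then show ?case
        using tendsto_norm[OF tendsto_diff[OF tendsto_const[of "g x"] elim]] by simp
    qed
    show "AE x in M. norm (norm (g x - u k x)) \<le> 2 * W x" for k
      using lim bound
    proof eventually_elim
      case (elim x)
      have "norm (g x) \<le> W x"
        using elim by (intro Lim_bounded[OF tendsto_norm]) auto
      then show ?case
        using norm_triangle_ineq4[of "g x" "u k x"] spec[OF elim(2), of k] by simp
    qed
  qed (use W in auto)
  then show ?thesis
    using g by auto
qed


section \<open>Integration on the Heisenberg group\<close>

lemma nn_integral_lborel_translate:
  fixes c :: "'a::euclidean_space"
  assumes [measurable]: "f \<in> borel_measurable borel"
  shows "(\<integral>\<^sup>+x. f (x + c) \<partial>lborel) = (\<integral>\<^sup>+x. f x \<partial>lborel)"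
proof -
  have "(\<integral>\<^sup>+x. f (x + c) \<partial>lborel) = (\<integral>\<^sup>+x. f x \<partial>distr lborel borel (\<lambda>x. x + c))"
    by (rule nn_integral_distr[symmetric]) auto
  then show ?thesis by (simp only: lborel_distr_plus_right)
qed

lemma lborel_distr_uminus_euclidean: "distr lborel borel uminus = (lborel :: 'a::euclidean_space measure)"
  using lborel_affine[of "-1" "0 :: 'a"] by (simp add: density_1)

lemma heis_mult_measurable [measurable (raw)]:
  fixes f g :: "'a \<Rightarrow> 'n::finite heis"
  assumes "f \<in> borel_measurable M" "g \<in> borel_measurable M"
  shows "(\<lambda>x. heis_mult (f x) (g x)) \<in> borel_measurable M"
  using assms
  by (rule borel_measurable_continuous_Pair) (unfold heis_mult_def, intro continuous_intros, simp)

text \<open>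
  A right translation is a translation in \<open>z\<close> followed, for each \<open>z\<close>, by a translation in \<open>t\<close>.
\<close>

lemma nn_integral_heis_mult_right:
  fixes q :: "'n::finite heis"
  assumes [measurable]: "f \<in> borel_measurable borel"
  shows "(\<integral>\<^sup>+p. f (heis_mult p q) \<partial>lborel) = (\<integral>\<^sup>+p. f p \<partial>lborel)"
proof -
  have [measurable]: "f \<in> borel_measurable (borel \<Otimes>\<^sub>M borel)"
    by (simp add: borel_prod)
  let ?s = "\<lambda>z. snd q + Im (\<Sum>j\<in>UNIV. z $ j * cnj (fst q $ j)) / 2"
  have "(\<integral>\<^sup>+p. f (heis_mult p q) \<partial>lborel) = (\<integral>\<^sup>+p. f (heis_mult p q) \<partial>(lborel \<Otimes>\<^sub>M lborel))"
    by (simp only: lborel_prod)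
  also have "\<dots> = (\<integral>\<^sup>+z. \<integral>\<^sup>+t. f (heis_mult (z, t) q) \<partial>lborel \<partial>lborel)"
    by (rule lborel.nn_integral_fst[symmetric]) (simp add: lborel_prod)
  also have "\<dots> = (\<integral>\<^sup>+z. \<integral>\<^sup>+t. f (z + fst q, t + ?s z) \<partial>lborel \<partial>lborel)"
    by (simp add: heis_mult_def add.assoc)
  also have "\<dots> = (\<integral>\<^sup>+z. \<integral>\<^sup>+t. f (z + fst q, t) \<partial>lborel \<partial>lborel)"
    by (intro nn_integral_cong nn_integral_lborel_translate[of "\<lambda>t. f (_, t)"]) measurable
  also have "\<dots> = (\<integral>\<^sup>+z. \<integral>\<^sup>+t. f (z, t) \<partial>lborel \<partial>lborel)"
    by (rule nn_integral_lborel_translate[of "\<lambda>z. \<integral>\<^sup>+t. f (z, t) \<partial>lborel"]) measurable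
  also have "\<dots> = (\<integral>\<^sup>+p. f p \<partial>(lborel \<Otimes>\<^sub>M lborel))"
    by (rule lborel.nn_integral_fst) (simp add: lborel_prod)
  finally show ?thesis by (simp only: lborel_prod)
qed

lemma heis_L1_measurable: "f \<in> heis_L1 \<Longrightarrow> f \<in> borel_measurable borel"
  by (auto simp: heis_L1_def)

lemma heis_L1_linear: "f \<in> heis_L1 \<Longrightarrow> g \<in> heis_L1 \<Longrightarrow> (\<lambda>p. a * f p + b * g p) \<in> heis_L1"
  by (simp add: heis_L1_def)

lemma nn_integral_norm_L1: "f \<in> heis_L1 \<Longrightarrow> (\<integral>\<^sup>+p. ennreal (cmod (f p)) \<partial>lborel) = ennreal (L1_norm f)"
  by (simp add: heis_L1_def L1_norm_def nn_integral_eq_integral)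

lemma L1_norm_nonneg: "0 \<le> L1_norm f"
  by (simp add: L1_norm_def)

lemma heis_L1_translate:
  assumes "f \<in> heis_L1"
  shows "heis_translate p f \<in> heis_L1" "L1_norm (heis_translate p f) = L1_norm f"
proof -
  note [measurable] = heis_L1_measurable[OF assms]
  have *: "(\<integral>\<^sup>+q. ennreal (cmod (heis_translate p f q)) \<partial>lborel) = ennreal (L1_norm f)"
    unfolding heis_translate_def using assms
    by (simp add: nn_integral_heis_mult_right[of "\<lambda>q. ennreal (cmod (f q))"] nn_integral_norm_L1)
  show "heis_translate p f \<in> heis_L1"
    using * by (auto simp: heis_L1_def integrable_iff_bounded heis_translate_def[abs_def])
  then show "L1_norm (heis_translate p f) = L1_norm f"
    using * by (simp add: nn_integral_norm_L1 L1_norm_nonneg)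
qed

lemma heis_L1_star:
  assumes "f \<in> heis_L1"
  shows "heis_star f \<in> heis_L1" "L1_norm (heis_star f) = L1_norm f"
proof -
  note [measurable] = heis_L1_measurable[OF assms]
  have "integrable (distr lborel borel uminus) f"
    using assms by (simp add: lborel_distr_uminus_euclidean heis_L1_def)
  then have "integrable lborel (\<lambda>p. f (- p))"
    by (subst (asm) integrable_distr_eq) auto
  then show "heis_star f \<in> heis_L1"
    by (simp add: heis_L1_def heis_star_def[abs_def])
  have "L1_norm (heis_star f) = (\<integral>p. cmod (f p) \<partial>distr lborel borel uminus)"
    unfolding L1_norm_def heis_star_def by (subst integral_distr) auto
  then show "L1_norm (heis_star f) = L1_norm f"
    by (simp add: lborel_distr_uminus_euclidean L1_norm_def)
qed

lemma heis_star_star: "heis_star (heis_star f) = f"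
  by (simp add: heis_star_def fun_eq_iff)

lemma heis_conv_kernel:
  assumes "f \<in> heis_L1" "g \<in> heis_L1"
  shows "integrable (lborel \<Otimes>\<^sub>M lborel) (\<lambda>(p, q). f (heis_mult p (- q)) * g q)"
    and "(\<integral>(p, q). cmod (f (heis_mult p (- q)) * g q) \<partial>(lborel \<Otimes>\<^sub>M lborel)) = L1_norm f * L1_norm g"
proof -
  note [measurable] = heis_L1_measurable[OF assms(1)] heis_L1_measurable[OF assms(2)]
  have *: "(\<integral>\<^sup>+(p, q). ennreal (cmod (f (heis_mult p (- q)) * g q)) \<partial>(lborel \<Otimes>\<^sub>M lborel))
      = ennreal (L1_norm f * L1_norm g)"
  proof -
    have "(\<integral>\<^sup>+(p, q). ennreal (cmod (f (heis_mult p (- q)) * g q)) \<partial>(lborel \<Otimes>\<^sub>M lborel))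
        = (\<integral>\<^sup>+q. \<integral>\<^sup>+p. ennreal (cmod (f (heis_mult p (- q)) * g q)) \<partial>lborel \<partial>lborel)"
      by (subst lborel_pair.nn_integral_snd[symmetric]) simp_all
    also have "\<dots> = (\<integral>\<^sup>+q. ennreal (L1_norm f) * ennreal (cmod (g q)) \<partial>lborel)"
      using assms
      by (simp add: norm_mult ennreal_mult nn_integral_multc nn_integral_norm_L1
          nn_integral_heis_mult_right[of "\<lambda>q. ennreal (cmod (f q))"])
    also have "\<dots> = ennreal (L1_norm f * L1_norm g)"
      using assms by (simp add: nn_integral_cmult nn_integral_norm_L1 ennreal_mult L1_norm_nonneg)
    finally show ?thesis .
  qed
  show "integrable (lborel \<Otimes>\<^sub>M lborel) (\<lambda>(p, q). f (heis_mult p (- q)) * g q)"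
    using * by (auto simp: integrable_iff_bounded case_prod_beta')
  then show "(\<integral>(p, q). cmod (f (heis_mult p (- q)) * g q) \<partial>(lborel \<Otimes>\<^sub>M lborel)) = L1_norm f * L1_norm g"
    using * L1_norm_nonneg[of f] L1_norm_nonneg[of g]
    by (subst integral_eq_nn_integral) (auto simp: case_prod_beta' integrable_iff_bounded)
qed

lemma heis_L1_conv:
  assumes "f \<in> heis_L1" "g \<in> heis_L1"
  shows "heis_conv f g \<in> heis_L1" "L1_norm (heis_conv f g) \<le> L1_norm f * L1_norm g"
proof -
  note kernel = heis_conv_kernel[OF assms]
  show conv: "heis_conv f g \<in> heis_L1"
    using lborel_pair.integrable_fst'[OF kernel(1)] by (simp add: heis_L1_def heis_conv_def[abs_def])
  have int: "integrable (lborel \<Otimes>\<^sub>M lborel) (\<lambda>(p, q). cmod (f (heis_mult p (- q)) * g q))"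
    using integrable_norm[OF kernel(1)] by (simp add: case_prod_beta')
  have "L1_norm (heis_conv f g) \<le> (\<integral>p. \<integral>q. cmod (f (heis_mult p (- q)) * g q) \<partial>lborel \<partial>lborel)"
    unfolding L1_norm_def
  proof (rule integral_mono)
    show "integrable lborel (\<lambda>p. cmod (heis_conv f g p))"
      using conv by (simp add: heis_L1_def)
    show "integrable lborel (\<lambda>p. \<integral>q. cmod (f (heis_mult p (- q)) * g q) \<partial>lborel)"
      using lborel_pair.integrable_fst'[OF int] by simp
    show "cmod (heis_conv f g p) \<le> (\<integral>q. cmod (f (heis_mult p (- q)) * g q) \<partial>lborel)" for p
      unfolding heis_conv_def by (rule integral_norm_bound)
  qed
  also have "\<dots> = L1_norm f * L1_norm g"
    using lborel_pair.integral_fst'[OF int] kernel(2) by simp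
  finally show "L1_norm (heis_conv f g) \<le> L1_norm f * L1_norm g" .
qed

lemma heis_conv_diff_left:
  assumes "f \<in> heis_L1" "g \<in> heis_L1" "h \<in> heis_L1"
  shows "AE p in lborel. heis_conv f h p - heis_conv g h p = heis_conv (\<lambda>p. f p - g p) h p"
  using lborel_pair.AE_integrable_fst'[OF heis_conv_kernel(1)[OF assms(1,3)]]
    lborel_pair.AE_integrable_fst'[OF heis_conv_kernel(1)[OF assms(2,3)]]
  by eventually_elim (simp add: heis_conv_def left_diff_distrib)

lemma L1_norm_conv_diff_left:
  assumes "f \<in> heis_L1" "g \<in> heis_L1" "h \<in> heis_L1"
  shows "L1_norm (\<lambda>p. heis_conv f h p - heis_conv g h p) \<le> L1_norm (\<lambda>p. f p - g p) * L1_norm h"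
proof -
  have diff: "(\<lambda>p. f p - g p) \<in> heis_L1"
    using assms by (simp add: heis_L1_def)
  note conv = heis_L1_conv[OF assms(1,3)] heis_L1_conv[OF assms(2,3)] heis_L1_conv[OF diff assms(3)]
  have "L1_norm (\<lambda>p. heis_conv f h p - heis_conv g h p) = L1_norm (heis_conv (\<lambda>p. f p - g p) h)"
    unfolding L1_norm_def using heis_conv_diff_left[OF assms] conv
    by (intro integral_cong_AE) (auto simp: heis_L1_def elim!: eventually_mono)
  then show ?thesis
    using conv by simp
qed

text \<open>
  The Neumann series \<open>h + h * h + \<dots>\<close>, obtained as the fixed point of \<open>g \<mapsto> h + g * h\<close>, which
  contracts distances by the factor \<open>\<parallel>h\<parallel> < 1\<close>. As \<open>(1 + g) * (1 - h) = 1\<close> formally, such a \<open>g\<close>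
  stands in for the inverse of \<open>1 - h\<close> in an algebra without unit.
\<close>

lemma quasi_inverse_exists:
  assumes h: "h \<in> heis_L1" "L1_norm h < 1"
  shows "\<exists>g\<in>heis_L1. AE p in lborel. g p = h p + heis_conv g h p"
proof -
  define r where "r = L1_norm h"
  have r: "0 \<le> r" "r < 1"
    using h by (simp_all add: r_def L1_norm_nonneg)
  \<comment> \<open>The Picard iterates starting from 0, that is, the partial sums of the Neumann series.\<close>
  define s where "s k = ((\<lambda>g p. h p + heis_conv g h p) ^^ k) (\<lambda>_. 0)" for k
  have s_Suc: "s (Suc k) = (\<lambda>p. h p + heis_conv (s k) h p)" for k
    by (simp add: s_def)
  have s: "s k \<in> heis_L1" for k
  proof (induction k)
    case 0
    then show ?case by (simp add: s_def heis_L1_def)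
  next
    case (Suc k)
    then show ?case
      using heis_L1_conv(1)[OF Suc h(1)] h(1) by (simp add: s_Suc heis_L1_def)
  qed
  have step: "L1_norm (\<lambda>p. s (Suc k) p - s k p) \<le> r ^ k * L1_norm (s (Suc 0))" for k
  proof (induction k)
    case 0
    then show ?case by (simp add: s_def)
  next
    case (Suc k)
    have "L1_norm (\<lambda>p. s (Suc (Suc k)) p - s (Suc k) p) \<le> L1_norm (\<lambda>p. s (Suc k) p - s k p) * r"
      using L1_norm_conv_diff_left[OF s[of "Suc k"] s[of k] h(1)]
      by (simp add: s_Suc[of "Suc k"] s_Suc[of k] r_def)
    also have "\<dots> \<le> (r ^ k * L1_norm (s (Suc 0))) * r"
      by (intro mult_right_mono Suc r)
    finally show ?case by (simp add: mult_ac)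
  qed
  have "summable (\<lambda>k. L1_norm (\<lambda>p. s (Suc k) p - s k p))"
    by (rule summable_comparison_test'[of "\<lambda>k. r ^ k * L1_norm (s (Suc 0))" 0])
       (use r step in \<open>auto intro!: summable_mult2 summable_geometric simp: L1_norm_nonneg\<close>)
  then obtain g where g: "integrable lborel g" and lim: "(\<lambda>k. L1_norm (\<lambda>p. g p - s k p)) \<longlonglongrightarrow> 0"
    using L1_limit_exists[of lborel s] s by (auto simp: heis_L1_def L1_norm_def)
  have gL1: "g \<in> heis_L1"
    using g by (simp add: heis_L1_def)
  let ?e = "\<lambda>p. g p - (h p + heis_conv g h p)"
  have e: "integrable lborel ?e"
    using gL1 h(1) heis_L1_conv(1)[OF gL1 h(1)] by (simp add: heis_L1_def)
  have "L1_norm ?e \<le> L1_norm (\<lambda>p. g p - s (Suc k) p) + L1_norm (\<lambda>p. g p - s k p) * r" for k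
  proof -
    have int: "integrable lborel (\<lambda>p. g p - s (Suc k) p)"
      "integrable lborel (\<lambda>p. heis_conv g h p - heis_conv (s k) h p)"
      using gL1 s heis_L1_conv(1)[OF gL1 h(1)] heis_L1_conv(1)[OF s h(1)] by (simp_all add: heis_L1_def)
    have "L1_norm ?e \<le> (\<integral>p. cmod (g p - s (Suc k) p) + cmod (heis_conv g h p - heis_conv (s k) h p) \<partial>lborel)"
      unfolding L1_norm_def
    proof (rule integral_mono)
      show "cmod (?e p) \<le> cmod (g p - s (Suc k) p) + cmod (heis_conv g h p - heis_conv (s k) h p)" for p
        using norm_triangle_ineq4[of "g p - s (Suc k) p" "heis_conv g h p - heis_conv (s k) h p"]
        by (simp add: s_Suc algebra_simps)
    qed (use int e in auto)
    also have "\<dots> = L1_norm (\<lambda>p. g p - s (Suc k) p) + L1_norm (\<lambda>p. heis_conv g h p - heis_conv (s k) h p)"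
      using int by (simp add: L1_norm_def)
    also have "\<dots> \<le> L1_norm (\<lambda>p. g p - s (Suc k) p) + L1_norm (\<lambda>p. g p - s k p) * r"
      unfolding r_def by (intro add_left_mono L1_norm_conv_diff_left gL1 s h)
    finally show ?thesis .
  qed
  moreover have "(\<lambda>k. L1_norm (\<lambda>p. g p - s (Suc k) p) + L1_norm (\<lambda>p. g p - s k p) * r) \<longlonglongrightarrow> 0 + 0 * r"
    by (intro tendsto_intros lim LIMSEQ_Suc[OF lim])
  ultimately have "L1_norm ?e \<le> 0 + 0 * r"
    by (intro LIMSEQ_le_const) auto
  then have "(\<integral>p. cmod (?e p) \<partial>lborel) = 0"
    using L1_norm_nonneg[of ?e] by (intro antisym) (simp_all add: L1_norm_def)
  then have "AE p in lborel. cmod (?e p) = 0"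
    using e by (subst (asm) integral_nonneg_eq_0_iff_AE) auto
  then show ?thesis
    using gL1 by (intro bexI[of _ g]) (auto elim: eventually_mono)
qed


section \<open>A Fubini theorem for bounded functionals\<close>

lemma integrable_complex_indicator:
  assumes "A \<in> sets M" "emeasure M A < \<infinity>"
  shows "integrable M (indicator A :: _ \<Rightarrow> complex)"
proof -
  have "integrable M (\<lambda>x. complex_of_real (indicator A x))"
    using assms by (intro integrable_of_real integrable_real_indicator)
  then show ?thesis by (simp add: of_real_indicator)
qed

text \<open>
  A bounded functional \<open>L\<close> on \<open>L\<^sup>1\<close> may be exchanged with an integral over a parameter:
  \<open>\<integral> L (F (\<cdot>, y)) dy = L (\<integral> F (\<cdot>, y) dy)\<close>. Working with the set of all \<open>F\<close> on the product space
  for which this holds keeps the argument elementary: indicators of rectangles belong to it,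
  and it is closed under linear combinations and dominated limits.
\<close>

locale L1_functional = pair_sigma_finite M1 M2
  for M1 :: "'a measure" and M2 :: "'b measure" +
  fixes L :: "('a \<Rightarrow> complex) \<Rightarrow> complex" and C :: real
  assumes L_linear: "\<And>f g a b. integrable M1 f \<Longrightarrow> integrable M1 g \<Longrightarrow>
      L (\<lambda>x. a * f x + b * g x) = a * L f + b * L g"
    and L_bound: "\<And>f. integrable M1 f \<Longrightarrow> cmod (L f) \<le> C * (\<integral>x. cmod (f x) \<partial>M1)"
begin

lemma L_diff:
  "integrable M1 f \<Longrightarrow> integrable M1 g \<Longrightarrow> L f - L g = L (\<lambda>x. f x - g x)"
  using L_linear[of f g 1 "-1"] by simp

lemma L_cmult: "integrable M1 f \<Longrightarrow> L (\<lambda>x. c * f x) = c * L f"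
  using L_linear[of f f c 0] by simp

lemma L_cong_AE:
  assumes "integrable M1 f" "integrable M1 g" "AE x in M1. f x = g x"
  shows "L f = L g"
proof -
  have "(\<integral>x. cmod (f x - g x) \<partial>M1) = 0"
    using assms(3) by (intro integral_eq_zero_AE) (auto elim: eventually_mono)
  then show ?thesis
    using L_bound[of "\<lambda>x. f x - g x"] L_diff[of f g] assms by simp
qed

lemma L_tendsto:
  assumes "\<And>i. integrable M1 (f i)" "integrable M1 g"
    and "(\<lambda>i. \<integral>x. cmod (f i x - g x) \<partial>M1) \<longlonglongrightarrow> 0"
  shows "(\<lambda>i. L (f i)) \<longlonglongrightarrow> L g"
proof -
  have "(\<lambda>i. L (f i) - L g) \<longlonglongrightarrow> 0"
  proof (rule Lim_null_comparison)
    show "(\<lambda>i. C * (\<integral>x. cmod (f i x - g x) \<partial>M1)) \<longlonglongrightarrow> 0"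
      using tendsto_mult_right_zero[OF assms(3)] by simp
    show "\<forall>\<^sub>F i in sequentially. norm (L (f i) - L g) \<le> C * (\<integral>x. cmod (f i x - g x) \<partial>M1)"
      using assms by (intro always_eventually allI) (simp add: L_diff L_bound)
  qed
  then show ?thesis by (rule LIM_zero_cancel)
qed

text \<open>
  The sections \<open>x \<mapsto> F (x, y)\<close> are integrable only for almost every \<open>y\<close>, hence the auxiliary
  function \<open>v\<close>; its measurability is part of the claim.
\<close>

definition commutes :: "('a \<times> 'b \<Rightarrow> complex) \<Rightarrow> bool" where
  "commutes F \<longleftrightarrow> (\<exists>v. integrable M2 v \<and> (AE y in M2. v y = L (\<lambda>x. F (x, y))) \<and>
     (\<integral>y. v y \<partial>M2) = L (\<lambda>x. \<integral>y. F (x, y) \<partial>M2))"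

lemma commutes_linear:
  assumes "integrable (M1 \<Otimes>\<^sub>M M2) F" "integrable (M1 \<Otimes>\<^sub>M M2) G" "commutes F" "commutes G"
  shows "commutes (\<lambda>p. a * F p + b * G p)"
proof -
  obtain v where v: "integrable M2 v" "AE y in M2. v y = L (\<lambda>x. F (x, y))"
    "(\<integral>y. v y \<partial>M2) = L (\<lambda>x. \<integral>y. F (x, y) \<partial>M2)"
    using assms(3) by (auto simp: commutes_def)
  obtain w where w: "integrable M2 w" "AE y in M2. w y = L (\<lambda>x. G (x, y))"
    "(\<integral>y. w y \<partial>M2) = L (\<lambda>x. \<integral>y. G (x, y) \<partial>M2)"
    using assms(4) by (auto simp: commutes_def)
  have F_snd: "AE y in M2. integrable M1 (\<lambda>x. F (x, y))" "AE y in M2. integrable M1 (\<lambda>x. G (x, y))"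
    using AE_integrable_snd[of "\<lambda>x y. F (x, y)"] AE_integrable_snd[of "\<lambda>x y. G (x, y)"] assms
    by simp_all
  have fst: "AE x in M1. integrable M2 (\<lambda>y. F (x, y))" "AE x in M1. integrable M2 (\<lambda>y. G (x, y))"
    using AE_integrable_fst' assms by auto
  note int = integrable_fst'[OF assms(1)] integrable_fst'[OF assms(2)]
  have FG: "integrable (M1 \<Otimes>\<^sub>M M2) (\<lambda>p. a * F p + b * G p)"
    using assms by auto
  show ?thesis
    unfolding commutes_def
  proof (intro exI[of _ "\<lambda>y. a * v y + b * w y"] conjI)
    show "integrable M2 (\<lambda>y. a * v y + b * w y)"
      using v w by auto
    show "AE y in M2. a * v y + b * w y = L (\<lambda>x. a * F (x, y) + b * G (x, y))"
      using F_snd v(2) w(2) by eventually_elim (simp add: L_linear)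
    have "L (\<lambda>x. \<integral>y. a * F (x, y) + b * G (x, y) \<partial>M2)
        = L (\<lambda>x. a * (\<integral>y. F (x, y) \<partial>M2) + b * (\<integral>y. G (x, y) \<partial>M2))"
    proof (rule L_cong_AE)
      show "integrable M1 (\<lambda>x. \<integral>y. a * F (x, y) + b * G (x, y) \<partial>M2)"
        by (rule integrable_fst'[OF FG])
      show "AE x in M1. (\<integral>y. a * F (x, y) + b * G (x, y) \<partial>M2)
          = a * (\<integral>y. F (x, y) \<partial>M2) + b * (\<integral>y. G (x, y) \<partial>M2)"
        using fst by eventually_elim simp
    qed (use int in auto)
    then show "(\<integral>y. a * v y + b * w y \<partial>M2) = L (\<lambda>x. \<integral>y. a * F (x, y) + b * G (x, y) \<partial>M2)"
      using v w int by (simp add: L_linear)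
  qed
qed

text \<open>
  By Fubini's theorem, dominated convergence on the product space yields convergence in the
  mean of almost every section and of the integrals over \<open>y\<close>, and \<open>L\<close> is continuous for it.
\<close>

lemma commutes_dominated_limit:
  assumes int: "\<And>i. integrable (M1 \<Otimes>\<^sub>M M2) (F i)" and F0: "F0 \<in> borel_measurable (M1 \<Otimes>\<^sub>M M2)"
    and G: "integrable (M1 \<Otimes>\<^sub>M M2) G"
    and lim: "\<And>p. p \<in> space (M1 \<Otimes>\<^sub>M M2) \<Longrightarrow> (\<lambda>i. F i p) \<longlonglongrightarrow> F0 p"
    and bound: "\<And>i p. p \<in> space (M1 \<Otimes>\<^sub>M M2) \<Longrightarrow> cmod (F i p) \<le> G p"
    and comm: "\<And>i. commutes (F i)"
  shows "commutes F0"
proof -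
  have bound0: "cmod (F0 p) \<le> G p" if "p \<in> space (M1 \<Otimes>\<^sub>M M2)" for p
    using bound[OF that] by (intro Lim_bounded[OF tendsto_norm[OF lim[OF that]]]) auto
  have F0_int: "integrable (M1 \<Otimes>\<^sub>M M2) F0"
    using G F0 bound0 by (intro Bochner_Integration.integrable_bound[OF G]) (auto intro!: AE_I2 order_trans[OF bound0 abs_ge_self])
  have diff_lim: "(\<lambda>i. cmod (F i p - F0 p)) \<longlonglongrightarrow> 0" if "p \<in> space (M1 \<Otimes>\<^sub>M M2)" for p
    using tendsto_norm[OF LIM_zero[OF lim[OF that]]] by simp
  have diff_bound: "cmod (F i p - F0 p) \<le> 2 * G p" if "p \<in> space (M1 \<Otimes>\<^sub>M M2)" for i p
    using norm_triangle_ineq4[of "F i p" "F0 p"] bound[OF that, of i] bound0[OF that] by linarith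
  obtain v where v: "\<And>i. integrable M2 (v i)" "\<And>i. AE y in M2. v i y = L (\<lambda>x. F i (x, y))"
    and v_int: "\<And>i. (\<integral>y. v i y \<partial>M2) = L (\<lambda>x. \<integral>y. F i (x, y) \<partial>M2)"
    using comm unfolding commutes_def by metis
  have [measurable]: "v i \<in> borel_measurable M2" for i
    using v by auto
  define u where "u y = lim (\<lambda>i. v i y)" for y
  have [measurable]: "u \<in> borel_measurable M2"
    unfolding u_def by measurable
  have snd: "AE y in M2. integrable M1 (\<lambda>x. H (x, y))" if "integrable (M1 \<Otimes>\<^sub>M M2) H"
    for H :: "_ \<Rightarrow> _::{banach, second_countable_topology}"
    using AE_integrable_snd[of "\<lambda>x y. H (x, y)"] that by simp
  have all_F: "AE y in M2. \<forall>i. integrable M1 (\<lambda>x. F i (x, y))" "AE y in M2. \<forall>i. v i y = L (\<lambda>x. F i (x, y))"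
    using snd[OF int] v(2) by (simp_all add: AE_all_countable)
  have lim_v: "AE y in M2. (\<lambda>i. v i y) \<longlonglongrightarrow> L (\<lambda>x. F0 (x, y))"
    using all_F snd[OF F0_int] snd[OF G] AE_space
  proof eventually_elim
    case (elim y)
    have "(\<lambda>i. L (\<lambda>x. F i (x, y))) \<longlonglongrightarrow> L (\<lambda>x. F0 (x, y))"
    proof (rule L_tendsto)
      have "(\<lambda>i. \<integral>x. cmod (F i (x, y) - F0 (x, y)) \<partial>M1) \<longlonglongrightarrow> (\<integral>x. 0 \<partial>M1)"
      proof (rule integral_dominated_convergence[where w = "\<lambda>x. 2 * G (x, y)"])
        show "AE x in M1. (\<lambda>i. cmod (F i (x, y) - F0 (x, y))) \<longlonglongrightarrow> 0"
          using elim(5) by (intro AE_I2 diff_lim) (simp add: space_pair_measure)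
        show "AE x in M1. norm (cmod (F i (x, y) - F0 (x, y))) \<le> 2 * G (x, y)" for i
          using elim(5) by (intro AE_I2) (simp add: space_pair_measure diff_bound)
        show "(\<lambda>x. cmod (F i (x, y) - F0 (x, y))) \<in> borel_measurable M1" for i
          using elim by (intro borel_measurable_integrable integrable_norm Bochner_Integration.integrable_diff) auto
      qed (use elim in auto)
      then show "(\<lambda>i. \<integral>x. cmod (F i (x, y) - F0 (x, y)) \<partial>M1) \<longlonglongrightarrow> 0"
        by simp
    qed (use elim in auto)
    then show ?case
      using elim(2) by simp
  qed
  then have lim_u: "AE y in M2. (\<lambda>i. v i y) \<longlonglongrightarrow> u y" and u: "AE y in M2. u y = L (\<lambda>x. F0 (x, y))"
    by (eventually_elim, simp add: u_def limI)+
  have C_nonneg: "C * (\<integral>x. cmod (f x) \<partial>M1) \<le> \<bar>C\<bar> * (\<integral>x. cmod (f x) \<partial>M1)" for f :: "'a \<Rightarrow> complex"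
    by (intro mult_right_mono) auto
  have v_bound: "AE y in M2. cmod (v i y) \<le> \<bar>C\<bar> * (\<integral>x. G (x, y) \<partial>M1)" for i
    using all_F snd[OF G] AE_space
  proof eventually_elim
    case (elim y)
    have "cmod (v i y) \<le> C * (\<integral>x. cmod (F i (x, y)) \<partial>M1)"
      using elim by (simp add: L_bound)
    also have "\<dots> \<le> \<bar>C\<bar> * (\<integral>x. cmod (F i (x, y)) \<partial>M1)"
      by (rule C_nonneg)
    also have "\<dots> \<le> \<bar>C\<bar> * (\<integral>x. G (x, y) \<partial>M1)"
      using elim bound by (intro mult_left_mono integral_mono) (auto simp: space_pair_measure)
    finally show ?case .
  qed
  have G_snd: "integrable M2 (\<lambda>y. \<bar>C\<bar> * (\<integral>x. G (x, y) \<partial>M1))"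
    using integrable_snd[of "\<lambda>x y. G (x, y)"] G by simp
  note dominated = _ _ G_snd lim_u v_bound
  have u_int: "integrable M2 u"
    by (rule integrable_dominated_convergence[OF dominated]) auto
  have "(\<lambda>i. \<integral>y. v i y \<partial>M2) \<longlonglongrightarrow> (\<integral>y. u y \<partial>M2)"
    by (rule integral_dominated_convergence[OF dominated]) auto
  moreover have "(\<lambda>i. L (\<lambda>x. \<integral>y. F i (x, y) \<partial>M2)) \<longlonglongrightarrow> L (\<lambda>x. \<integral>y. F0 (x, y) \<partial>M2)"
  proof (rule L_tendsto)
    show F_fst: "integrable M1 (\<lambda>x. \<integral>y. F i (x, y) \<partial>M2)" for i
      by (rule integrable_fst'[OF int])
    show F0_fst: "integrable M1 (\<lambda>x. \<integral>y. F0 (x, y) \<partial>M2)"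
      by (rule integrable_fst'[OF F0_int])
    have D: "integrable (M1 \<Otimes>\<^sub>M M2) (\<lambda>p. cmod (F i p - F0 p))" for i
      using int F0_int by auto
    show "(\<lambda>i. \<integral>x. cmod ((\<integral>y. F i (x, y) \<partial>M2) - (\<integral>y. F0 (x, y) \<partial>M2)) \<partial>M1) \<longlonglongrightarrow> 0"
    proof (rule Lim_null_comparison[OF always_eventually], rule allI)
      fix i
      have "(\<integral>x. cmod ((\<integral>y. F i (x, y) \<partial>M2) - (\<integral>y. F0 (x, y) \<partial>M2)) \<partial>M1)
          \<le> (\<integral>x. \<integral>y. cmod (F i (x, y) - F0 (x, y)) \<partial>M2 \<partial>M1)"
      proof (rule integral_mono_AE)
        show "AE x in M1. cmod ((\<integral>y. F i (x, y) \<partial>M2) - (\<integral>y. F0 (x, y) \<partial>M2))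
            \<le> (\<integral>y. cmod (F i (x, y) - F0 (x, y)) \<partial>M2)"
          using AE_integrable_fst'[OF int[of i]] AE_integrable_fst'[OF F0_int]
        proof eventually_elim
          case (elim x)
          then show ?case
            using integral_norm_bound[of M2 "\<lambda>y. F i (x, y) - F0 (x, y)"] by simp
        qed
        show "integrable M1 (\<lambda>x. \<integral>y. cmod (F i (x, y) - F0 (x, y)) \<partial>M2)"
          by (rule integrable_fst'[OF D])
      qed (use F_fst F0_fst in auto)
      also have "\<dots> = (\<integral>p. cmod (F i p - F0 p) \<partial>(M1 \<Otimes>\<^sub>M M2))"
        by (rule integral_fst'[OF D])
      finally show "norm (\<integral>x. cmod ((\<integral>y. F i (x, y) \<partial>M2) - (\<integral>y. F0 (x, y) \<partial>M2)) \<partial>M1)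
          \<le> (\<integral>p. cmod (F i p - F0 p) \<partial>(M1 \<Otimes>\<^sub>M M2))"
        by simp
    next
      have "(\<lambda>i. \<integral>p. cmod (F i p - F0 p) \<partial>(M1 \<Otimes>\<^sub>M M2)) \<longlonglongrightarrow> (\<integral>p. 0 \<partial>(M1 \<Otimes>\<^sub>M M2))"
        by (rule integral_dominated_convergence[where w = "\<lambda>p. 2 * G p"])
           (use D G in \<open>auto intro!: AE_I2 diff_lim diff_bound\<close>)
      then show "(\<lambda>i. \<integral>p. cmod (F i p - F0 p) \<partial>(M1 \<Otimes>\<^sub>M M2)) \<longlonglongrightarrow> 0"
        by simp
    qed
  qed
  ultimately have "(\<integral>y. u y \<partial>M2) = L (\<lambda>x. \<integral>y. F0 (x, y) \<partial>M2)"
    unfolding v_int by (rule LIMSEQ_unique)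
  then show ?thesis
    unfolding commutes_def using u_int u by blast
qed

lemma commutes_rectangle:
  assumes A: "A \<in> sets M1" "emeasure M1 A < \<infinity>" and B: "B \<in> sets M2" "emeasure M2 B < \<infinity>"
  shows "commutes (indicator (A \<times> B))"
proof -
  have ind: "(indicator (A \<times> B) (x, y) :: complex) = indicator B y * indicator A x" for x y
    by (auto split: split_indicator)
  have intA: "integrable M1 (indicator A :: _ \<Rightarrow> complex)" and intB: "integrable M2 (indicator B :: _ \<Rightarrow> complex)"
    using A B by (auto intro: integrable_complex_indicator)
  show ?thesis
    unfolding commutes_def ind
    by (intro exI[of _ "\<lambda>y. indicator B y * L (indicator A)"] conjI)
       (use intA intB L_cmult in \<open>auto\<close>)
qed

text \<open>
  Inside a rectangle of finite measure this is Dynkin's argument, rectangles being an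
  intersection-stable generator. Exhausting both factors by sets of finite measure removes
  the restriction.
\<close>

lemma commutes_indicator:
  assumes A: "A \<in> sets (M1 \<Otimes>\<^sub>M M2)" "emeasure (M1 \<Otimes>\<^sub>M M2) A < \<infinity>"
  shows "commutes (indicator A)"
proof -
  obtain K :: "nat \<Rightarrow> 'a set" where K: "range K \<subseteq> sets M1" "(\<Union>i. K i) = space M1"
    "\<And>i. emeasure M1 (K i) \<noteq> \<infinity>" "incseq K"
    using M1.sigma_finite_incseq by blast
  obtain K' :: "nat \<Rightarrow> 'b set" where K': "range K' \<subseteq> sets M2" "(\<Union>i. K' i) = space M2"
    "\<And>i. emeasure M2 (K' i) \<noteq> \<infinity>" "incseq K'"
    using M2.sigma_finite_incseq by blast
  have [measurable]: "K i \<in> sets M1" "K' i \<in> sets M2" for i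
    using K K' by auto
  define R where "R i = K i \<times> K' i" for i
  have [measurable]: "R i \<in> sets (M1 \<Otimes>\<^sub>M M2)" for i
    by (simp add: R_def)
  have R_finite: "emeasure (M1 \<Otimes>\<^sub>M M2) (R i) < \<infinity>" for i
    using K(3)[of i] K'(3)[of i]
    by (simp add: R_def M2.emeasure_pair_measure_Times ennreal_mult_less_top less_top)
  have int_R: "integrable (M1 \<Otimes>\<^sub>M M2) (indicator (S \<inter> R i) :: _ \<Rightarrow> complex)"
    if "S \<in> sets (M1 \<Otimes>\<^sub>M M2)" for S i
    using that le_less_trans[OF emeasure_mono[of "S \<inter> R i" "R i"] R_finite]
    by (auto intro!: integrable_complex_indicator)
  have inR: "commutes (indicator (A \<inter> R i))" for i
  proof -
    let ?E = "{a \<times> b |a b. a \<in> sets M1 \<and> b \<in> sets M2}"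
    have sets: "sigma_sets (space M1 \<times> space M2) ?E = sets (M1 \<Otimes>\<^sub>M M2)"
      by (simp add: sets_pair_measure)
    have rect: "commutes (indicator ((a \<times> b) \<inter> R i))" if [measurable]: "a \<in> sets M1" "b \<in> sets M2" for a b
    proof -
      have "(a \<times> b) \<inter> R i = (a \<inter> K i) \<times> (b \<inter> K' i)"
        by (auto simp: R_def)
      moreover have "emeasure M1 (a \<inter> K i) < \<infinity>" "emeasure M2 (b \<inter> K' i) < \<infinity>"
        using K(3)[of i] K'(3)[of i]
        by (auto intro!: le_less_trans[OF emeasure_mono[of _ "K i"]] le_less_trans[OF emeasure_mono[of _ "K' i"]]
            simp: less_top)
      ultimately show ?thesis
        using commutes_rectangle[of "a \<inter> K i" "b \<inter> K' i"] by simp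
    qed
    have commutes_empty: "commutes (indicator {})"
      using commutes_rectangle[of "{}" "{}"] unfolding Sigma_empty1 by simp
    have "Int_stable ?E" "?E \<subseteq> Pow (space M1 \<times> space M2)" "A \<in> sigma_sets (space M1 \<times> space M2) ?E"
      using A by (auto simp: Int_stable_pair_measure_generator sets dest: sets.sets_into_space)
    then show ?thesis
    proof (induction rule: sigma_sets_induct_disjoint)
      case (basic A)
      then show ?case using rect by auto
    next
      case empty
      then show ?case by (simp only: Int_empty_left commutes_empty)
    next
      case (compl A)
      then have A: "A \<in> sets (M1 \<Otimes>\<^sub>M M2)" by (simp add: sets)
      have top: "space M1 \<times> space M2 \<in> sets (M1 \<Otimes>\<^sub>M M2)" by auto
      have "commutes (\<lambda>p. 1 * indicator ((space M1 \<times> space M2) \<inter> R i) p + (-1) * indicator (A \<inter> R i) p)"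
        using compl rect[of "space M1" "space M2"] int_R[OF top] int_R[OF A]
        by (intro commutes_linear) auto
      also have "(\<lambda>p. 1 * indicator ((space M1 \<times> space M2) \<inter> R i) p + (-1) * indicator (A \<inter> R i) p)
          = (indicator ((space M1 \<times> space M2 - A) \<inter> R i) :: _ \<Rightarrow> complex)"
        using sets.sets_into_space[OF A] by (auto simp: fun_eq_iff space_pair_measure split: split_indicator)
      finally show ?case .
    next
      case (union S)
      then have S: "S n \<in> sets (M1 \<Otimes>\<^sub>M M2)" for n by (auto simp: sets)
      have partial: "commutes (indicator ((\<Union>j<n. S j) \<inter> R i))" for n
      proof (induction n)
        case 0
        then show ?case by (simp only: lessThan_0 UN_empty Int_empty_left commutes_empty)
      next
        case (Suc n)
        have U: "(\<Union>j<n. S j) \<in> sets (M1 \<Otimes>\<^sub>M M2)" using S by auto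
        have "commutes (\<lambda>p. 1 * indicator ((\<Union>j<n. S j) \<inter> R i) p + 1 * indicator (S n \<inter> R i) p)"
          using Suc union.IH int_R[OF U] int_R[OF S] by (intro commutes_linear) auto
        also have "(\<lambda>p. 1 * indicator ((\<Union>j<n. S j) \<inter> R i) p + 1 * indicator (S n \<inter> R i) p)
            = (indicator ((\<Union>j<Suc n. S j) \<inter> R i) :: _ \<Rightarrow> complex)"
        proof -
          have "S j \<inter> S n = {}" if "j < n" for j
            using union(1) that by (auto simp: disjoint_family_on_def)
          then show ?thesis
            by (fastforce simp: fun_eq_iff lessThan_Suc split: split_indicator)
        qed
        finally show ?case .
      qed
      show ?case
      proof (rule commutes_dominated_limit[where F = "\<lambda>n. indicator ((\<Union>j<n. S j) \<inter> R i)" and G = "indicator (R i)"])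
        have U: "(\<Union>j<n. S j) \<in> sets (M1 \<Otimes>\<^sub>M M2)" for n using S by auto
        show "integrable (M1 \<Otimes>\<^sub>M M2) (indicator ((\<Union>j<n. S j) \<inter> R i) :: _ \<Rightarrow> complex)" for n
          by (rule int_R[OF U])
        show "indicator ((\<Union>j. S j) \<inter> R i) \<in> borel_measurable (M1 \<Otimes>\<^sub>M M2)"
          using S by measurable
        show "integrable (M1 \<Otimes>\<^sub>M M2) (indicator (R i) :: _ \<Rightarrow> real)"
          using R_finite by (intro integrable_real_indicator) auto
        show "(\<lambda>n. indicator ((\<Union>j<n. S j) \<inter> R i) p :: complex) \<longlonglongrightarrow> indicator ((\<Union>j. S j) \<inter> R i) p" for p
        proof -
          have "(\<Union>j\<in>J. S j) \<inter> R i = (\<Union>j\<in>J. S j \<inter> R i)" for J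
            by auto
          then show ?thesis
            by (simp only: LIMSEQ_indicator_UN)
        qed
      qed (auto intro: partial split: split_indicator)
    qed
  qed
  show ?thesis
  proof (rule commutes_dominated_limit[where F = "\<lambda>n. indicator (A \<inter> R n)" and G = "indicator A"])
    show "(\<lambda>n. indicator (A \<inter> R n) p :: complex) \<longlonglongrightarrow> indicator A p" if p: "p \<in> space (M1 \<Otimes>\<^sub>M M2)" for p
    proof (rule tendsto_eventually)
      obtain a b where "fst p \<in> K a" "snd p \<in> K' b"
        using p K(2) K'(2) by (auto simp: space_pair_measure) blast
      moreover have "K a \<subseteq> K n" "K' b \<subseteq> K' n" if "n \<ge> max a b" for n
        using that K(4) K'(4) by (auto simp: incseq_def)
      ultimately have "p \<in> R n" if "n \<ge> max a b" for n
        using that by (cases p) (auto simp: R_def)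
      then show "\<forall>\<^sub>F n in sequentially. indicator (A \<inter> R n) p = (indicator A p :: complex)"
        by (intro eventually_sequentiallyI[of "max a b"]) (auto split: split_indicator)
    qed
    show "indicator A \<in> borel_measurable (M1 \<Otimes>\<^sub>M M2)" "integrable (M1 \<Otimes>\<^sub>M M2) (indicator A :: _ \<Rightarrow> real)"
      using A by (auto intro: integrable_real_indicator)
  qed (use A in \<open>auto intro: inR int_R split: split_indicator\<close>)
qed

lemma functional_integral_commute:
  assumes "integrable (M1 \<Otimes>\<^sub>M M2) F"
  shows "commutes F"
  using assms
proof (induction rule: integrable_induct)
  case (base A c)
  have "integrable (M1 \<Otimes>\<^sub>M M2) (indicator A :: _ \<Rightarrow> complex)"
    using base by (rule integrable_complex_indicator)
  then have "commutes (\<lambda>p. c * indicator A p + 0 * indicator A p)"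
    using commutes_indicator[OF base] by (intro commutes_linear)
  then show ?case
    by (simp add: scaleR_conv_of_real of_real_indicator mult.commute)
next
  case (add f g)
  then show ?case
    using commutes_linear[of f g 1 1] by simp
next
  case (lim f s)
  show ?case
  proof (rule commutes_dominated_limit[OF lim.hyps(1) _ _ lim.hyps(2,3) lim.IH])
    show "f \<in> borel_measurable (M1 \<Otimes>\<^sub>M M2)" "integrable (M1 \<Otimes>\<^sub>M M2) (\<lambda>p. 2 * cmod (f p))"
      using lim.hyps(4) by auto
  qed
qed

end


section \<open>Representations of the convolution algebra are contractive\<close>

text \<open>
  The values at one fixed \<open>\<lambda>\<close> of a map as in the theorem. Boundedness with respect to the
  \<open>L\<^sup>1\<close> norm is a consequence of the algebraic properties, proved below.
\<close>

locale L1_star_representation =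
  fixes B :: "('n::finite heis \<Rightarrow> complex) \<Rightarrow> 'a::euclidean_space l2_op"
  assumes bounded: "\<And>f. f \<in> heis_L1 \<Longrightarrow> B f \<in> bounded_ops"
    and cong_AE: "\<And>f g. f \<in> heis_L1 \<Longrightarrow> g \<in> heis_L1 \<Longrightarrow> AE p in lborel. f p = g p \<Longrightarrow> B f = B g"
    and linear: "\<And>f g a b \<phi>. f \<in> heis_L1 \<Longrightarrow> g \<in> heis_L1 \<Longrightarrow>
      blinfun_apply (B (\<lambda>p. a * f p + b * g p)) \<phi> =
        scaleC_l2 a (blinfun_apply (B f) \<phi>) + scaleC_l2 b (blinfun_apply (B g) \<phi>)"
    and star: "\<And>f. f \<in> heis_L1 \<Longrightarrow> B (heis_star f) = op_adjoint (B f)"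
    and conv: "\<And>f g. f \<in> heis_L1 \<Longrightarrow> g \<in> heis_L1 \<Longrightarrow> B (heis_conv f g) = B f o\<^sub>L B g"
begin

lemma cinner_star:
  "f \<in> heis_L1 \<Longrightarrow> cinner_l2 (blinfun_apply (B f) \<phi>) \<psi> = cinner_l2 \<phi> (blinfun_apply (B (heis_star f)) \<psi>)"
  by (simp add: star cinner_op_adjoint bounded)

text \<open>
  If \<open>h\<close> has norm below 1, then \<open>1 - B h\<close> has the left inverse \<open>1 + B g\<close> for the quasi-inverse
  \<open>g\<close> of \<open>h\<close>, and an operator with a bounded left inverse is bounded below.
\<close>

lemma bounded_below:
  assumes h: "h \<in> heis_L1" "L1_norm h < 1"
  shows "\<exists>K\<ge>1. \<forall>\<phi>. norm \<phi> \<le> K * norm (\<phi> - blinfun_apply (B h) \<phi>)"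
proof -
  obtain g where g: "g \<in> heis_L1" "AE p in lborel. g p = h p + heis_conv g h p"
    using quasi_inverse_exists[OF h] by blast
  have gh: "heis_conv g h \<in> heis_L1"
    using g h by (intro heis_L1_conv)
  have "B g = B (\<lambda>p. 1 * h p + 1 * heis_conv g h p)"
    using g h gh by (intro cong_AE heis_L1_linear) simp_all
  then have Bg: "blinfun_apply (B g) \<phi>
      = blinfun_apply (B h) \<phi> + blinfun_apply (B g) (blinfun_apply (B h) \<phi>)" for \<phi>
    using linear[OF h(1) gh, of 1 1 \<phi>] conv[OF g(1) h(1)] by (simp add: scaleC_l2_one)
  have "norm \<phi> \<le> (1 + norm (B g)) * norm (\<phi> - blinfun_apply (B h) \<phi>)" for \<phi>
  proof -
    let ?d = "\<phi> - blinfun_apply (B h) \<phi>"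
    have "\<phi> = ?d + blinfun_apply (B g) ?d"
      using Bg[of \<phi>] by (simp add: blinfun.diff_right algebra_simps)
    then have "norm \<phi> \<le> norm ?d + norm (blinfun_apply (B g) ?d)"
      by (metis norm_triangle_ineq)
    also have "\<dots> \<le> norm ?d + norm (B g) * norm ?d"
      by (intro add_left_mono norm_blinfun)
    finally show ?thesis by (simp add: distrib_right)
  qed
  then show ?thesis
    by (intro exI[of _ "1 + norm (B g)"]) simp
qed

text \<open>
  With \<open>A = B f \<noteq> 0\<close> and \<open>M = \<parallel>A\<parallel>\<^sup>2\<close>, the operator \<open>1 - A\<^sup>* A / M\<close> is never bounded below: its square
  norm at \<open>\<phi>\<close> is at most \<open>\<parallel>\<phi>\<parallel>\<^sup>2 - \<parallel>A \<phi>\<parallel>\<^sup>2 / M\<close>, which comes arbitrarily close to 0 on the unit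
  sphere. If \<open>\<parallel>f\<parallel> < \<parallel>A\<parallel>\<close>, it is bounded below by the previous lemma, applied to \<open>f\<^sup>* * f / M\<close>.
\<close>

lemma contractive:
  assumes f: "f \<in> heis_L1"
  shows "norm (B f) \<le> L1_norm f"
proof (rule ccontr)
  assume "\<not> norm (B f) \<le> L1_norm f"
  then have less: "L1_norm f < norm (B f)" by simp
  define M where "M = (norm (B f))\<^sup>2"
  have "0 < norm (B f)"
    using less L1_norm_nonneg[of f] by linarith
  then have M: "0 < M"
    by (simp add: M_def)
  let ?A = "blinfun_apply (B f)" and ?A' = "blinfun_apply (B (heis_star f))"
  note fs = heis_L1_star[OF f]
  note k = heis_L1_conv[OF fs(1) f]
  \<comment> \<open>The vanishing second summand gives \<open>h\<close> the form in which linearity is assumed.\<close>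
  define h where "h p = complex_of_real (1 / M) * heis_conv (heis_star f) f p + 0 * f p" for p
  have h: "h \<in> heis_L1"
    unfolding h_def by (rule heis_L1_linear[OF k(1) f])
  have "L1_norm h = (1 / M) * L1_norm (heis_conv (heis_star f) f)"
    using M by (simp add: L1_norm_def h_def norm_divide)
  also have "\<dots> \<le> (1 / M) * (L1_norm f)\<^sup>2"
    using k(2) M by (intro mult_left_mono) (simp_all add: fs power2_eq_square)
  also have "\<dots> < 1"
    using power_strict_mono[OF less L1_norm_nonneg, of 2] M by (simp add: M_def)
  finally obtain K where K: "K \<ge> 1" "\<And>\<phi>. norm \<phi> \<le> K * norm (\<phi> - blinfun_apply (B h) \<phi>)"
    using bounded_below[OF h] by blast
  have Bh: "blinfun_apply (B h) \<phi> = (1 / M) *\<^sub>R ?A' (?A \<phi>)" for \<phi>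
    using linear[OF k(1) f, of "complex_of_real (1 / M)" 0 \<phi>]
    by (simp only: h_def[abs_def] conv[OF fs(1) f] blinfun_apply_blinfun_compose scaleC_l2_zero
        scaleR_eq_scaleC add_0_right)
  define c where "c = 1 - 1 / K\<^sup>2"
  have c: "0 \<le> c" "c < 1"
    using K(1) by (simp_all add: c_def divide_le_eq_1 one_le_power)
  have "norm (?A \<phi>) \<le> (sqrt c * norm (B f)) * norm \<phi>" for \<phi>
  proof -
    have inner_eq: "inner \<phi> (?A' (?A \<phi>)) = (norm (?A \<phi>))\<^sup>2"
      unfolding inner_l2_def cinner_star[OF f, symmetric] by (simp only: cinner_self Re_complex_of_real)
    have "norm (B (heis_star f)) \<le> norm (B f)"
      using norm_op_adjoint_le[OF bounded[OF f]] by (simp add: star f)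
    then have "norm (?A' (?A \<phi>)) \<le> norm (B f) * norm (?A \<phi>)"
      by (meson norm_blinfun mult_right_mono norm_ge_zero order_trans)
    then have star_bound: "(norm (?A' (?A \<phi>)))\<^sup>2 \<le> M * (norm (?A \<phi>))\<^sup>2"
      unfolding M_def by (metis norm_ge_zero power_mono power_mult_distrib)
    have expand: "(norm (\<phi> - r *\<^sub>R \<psi>))\<^sup>2 = (norm \<phi>)\<^sup>2 - 2 * r * inner \<phi> \<psi> + r\<^sup>2 * (norm \<psi>)\<^sup>2"
      for r and \<psi> :: "'a l2"
      unfolding power2_norm_eq_inner
      by (simp add: inner_diff_left inner_diff_right inner_commute[of \<psi> \<phi>] power2_eq_square algebra_simps)
    have "(norm (\<phi> - blinfun_apply (B h) \<phi>))\<^sup>2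
        = (norm \<phi>)\<^sup>2 - 2 * (norm (?A \<phi>))\<^sup>2 / M + (norm (?A' (?A \<phi>)))\<^sup>2 / M\<^sup>2"
      unfolding Bh expand inner_eq by (simp add: power_divide)
    also have "\<dots> \<le> (norm \<phi>)\<^sup>2 - 2 * (norm (?A \<phi>))\<^sup>2 / M + M * (norm (?A \<phi>))\<^sup>2 / M\<^sup>2"
      using star_bound by (intro add_left_mono divide_right_mono) simp_all
    also have "\<dots> = (norm \<phi>)\<^sup>2 - (norm (?A \<phi>))\<^sup>2 / M"
      using M by (simp add: power2_eq_square)
    finally have "K\<^sup>2 * (norm (\<phi> - blinfun_apply (B h) \<phi>))\<^sup>2 \<le> K\<^sup>2 * ((norm \<phi>)\<^sup>2 - (norm (?A \<phi>))\<^sup>2 / M)"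
      by (rule mult_left_mono) simp
    moreover have "(norm \<phi>)\<^sup>2 \<le> K\<^sup>2 * (norm (\<phi> - blinfun_apply (B h) \<phi>))\<^sup>2"
      using power_mono[OF K(2)[of \<phi>], of 2] by (simp add: power_mult_distrib)
    ultimately have "(norm \<phi>)\<^sup>2 \<le> K\<^sup>2 * ((norm \<phi>)\<^sup>2 - (norm (?A \<phi>))\<^sup>2 / M)"
      by linarith
    then have "(norm \<phi>)\<^sup>2 / K\<^sup>2 \<le> (norm \<phi>)\<^sup>2 - (norm (?A \<phi>))\<^sup>2 / M"
      using K(1) by (subst pos_divide_le_eq) (simp_all add: mult.commute)
    then have "(norm (?A \<phi>))\<^sup>2 / M \<le> c * (norm \<phi>)\<^sup>2"
      by (simp add: c_def left_diff_distrib)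
    then have "(norm (?A \<phi>))\<^sup>2 \<le> c * (norm \<phi>)\<^sup>2 * M"
      by (simp only: pos_divide_le_eq[OF M])
    also have "\<dots> = (sqrt c * norm (B f) * norm \<phi>)\<^sup>2"
      unfolding M_def power_mult_distrib real_sqrt_pow2[OF c(1)] by (simp only: mult_ac)
    finally show ?thesis
      by (rule power2_le_imp_le) (simp add: c)
  qed
  then have "norm (B f) \<le> sqrt c * norm (B f)"
    using c by (intro norm_blinfun_bound) auto
  moreover have "sqrt c * norm (B f) < 1 * norm (B f)"
    using c \<open>0 < norm (B f)\<close> by (intro mult_strict_right_mono) auto
  ultimately show False by simp
qed

lemma coefficient_functional:
  "L1_functional lborel (lborel :: 'n heis measure) (\<lambda>f. cinner_l2 (blinfun_apply (B f) \<phi>) \<psi>) (norm \<phi> * norm \<psi>)"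
proof
  fix f g :: "'n heis \<Rightarrow> complex" and a b :: complex
  assume "integrable lborel f" "integrable lborel g"
  then show "cinner_l2 (blinfun_apply (B (\<lambda>p. a * f p + b * g p)) \<phi>) \<psi>
      = a * cinner_l2 (blinfun_apply (B f) \<phi>) \<psi> + b * cinner_l2 (blinfun_apply (B g) \<phi>) \<psi>"
    by (simp add: linear heis_L1_def cinner_add_left cinner_scaleC_left)
next
  fix f :: "'n heis \<Rightarrow> complex"
  assume "integrable lborel f"
  then have "norm (B f) \<le> L1_norm f"
    by (intro contractive) (simp add: heis_L1_def)
  then have "norm (blinfun_apply (B f) \<phi>) \<le> L1_norm f * norm \<phi>"
    by (meson norm_blinfun mult_right_mono norm_ge_zero order_trans)
  then have "norm (blinfun_apply (B f) \<phi>) * norm \<psi> \<le> L1_norm f * norm \<phi> * norm \<psi>"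
    by (rule mult_right_mono) simp
  then show "cmod (cinner_l2 (blinfun_apply (B f) \<phi>) \<psi>) \<le> norm \<phi> * norm \<psi> * (\<integral>p. cmod (f p) \<partial>lborel)"
    using cmod_cinner_le[of "blinfun_apply (B f) \<phi>" \<psi>] by (simp add: L1_norm_def mult_ac)
qed

end


section \<open>Matrix coefficients of the Schroedinger representation\<close>

lemma schroedinger_in_bounded_ops: "schroedinger l p \<in> bounded_ops"
proof -
  have "blinfun_apply (schroedinger l p) (scaleC_l2 c \<phi>) = scaleC_l2 c (blinfun_apply (schroedinger l p) \<phi>)" for c \<phi>
  proof -
    obtain f where f: "square_integrable f" "\<phi> = abs_l2 f" by (rule l2_cases)
    then show ?thesis
      by (simp add: scaleC_abs_l2 schroedinger_abs_l2 square_integrable_cmult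
          square_integrable_schroedinger_fun schroedinger_fun_cmult)
  qed
  then show ?thesis by (simp add: bounded_ops_def)
qed

lemma norm_schroedinger: "norm (blinfun_apply (schroedinger l p) \<phi>) = norm \<phi>"
  by (simp add: schroedinger.rep_eq norm_schroedinger_l2)

lemma schroedinger_uminus: "blinfun_apply (schroedinger l p) (blinfun_apply (schroedinger l (- p)) \<phi>) = \<phi>"
proof -
  obtain f where f: "square_integrable f" "\<phi> = abs_l2 f" by (rule l2_cases)
  have coordinates: "Re_vec (- fst p) = - Re_vec (fst p)" "Im_vec (- fst p) = - Im_vec (fst p)"
    by (simp_all add: Re_vec_def Im_vec_def vec_eq_iff)
  have "schroedinger_fun l p (schroedinger_fun l (- p) f) = f"
    by (rule ext)
       (simp add: schroedinger_fun_def Let_def coordinates inner_diff_right inner_add_right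
         mult.assoc[symmetric] mult_exp_exp ring_distribs diff_divide_distrib flip: exp_add)
  then show ?thesis
    using f by (simp add: schroedinger_abs_l2 square_integrable_schroedinger_fun)
qed

lemma cinner_schroedinger:
  "cinner_l2 (blinfun_apply (schroedinger l p) \<phi>) (blinfun_apply (schroedinger l p) \<psi>) = cinner_l2 \<phi> \<psi>"
proof -
  have "inner (blinfun_apply (schroedinger l p) \<phi>) (blinfun_apply (schroedinger l p) \<psi>) = inner \<phi> \<psi>" for \<phi> \<psi>
    unfolding dot_norm by (simp add: norm_schroedinger flip: blinfun.add_right)
  then show ?thesis
    by (simp add: cinner_eq_inner flip: bounded_ops_scaleC[OF schroedinger_in_bounded_ops])
qed

lemma op_adjoint_schroedinger: "op_adjoint (schroedinger l p) = schroedinger l (- p)"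
proof (rule op_adjoint_eqI[OF schroedinger_in_bounded_ops])
  show "cinner_l2 (blinfun_apply (schroedinger l p) \<phi>) \<psi>
      = cinner_l2 \<phi> (blinfun_apply (schroedinger l (- p)) \<psi>)" for \<phi> \<psi>
    using cinner_schroedinger[of l p \<phi> "blinfun_apply (schroedinger l (- p)) \<psi>"]
    by (simp add: schroedinger_uminus)
qed

lemma schroedinger_coefficient_measurable [measurable]:
  "(\<lambda>p. cinner_l2 (blinfun_apply (schroedinger l p) \<phi>) \<psi>) \<in> borel_measurable borel"
proof -
  obtain f where f: "square_integrable f" "\<phi> = abs_l2 f" by (rule l2_cases)
  obtain g where g: "square_integrable g" "\<psi> = abs_l2 g" by (rule l2_cases)
  have [measurable]: "f \<in> borel_measurable borel" "g \<in> borel_measurable borel"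
    using f g by (auto simp: square_integrable_def)
  have [measurable]: "Re_vec \<in> borel_measurable borel" "Im_vec \<in> borel_measurable borel"
    unfolding Re_vec_def Im_vec_def
    by (intro borel_measurable_continuous_onI continuous_intros)+
  have "(\<lambda>p. \<integral>\<xi>. schroedinger_fun l p f \<xi> * cnj (g \<xi>) \<partial>lborel) \<in> borel_measurable (borel \<Otimes>\<^sub>M borel)"
    unfolding schroedinger_fun_def Let_def by measurable
  then show ?thesis
    by (simp add: f g schroedinger_abs_l2 cinner_abs_l2 square_integrable_schroedinger_fun borel_prod)
qed

lemma cmod_schroedinger_coefficient_le:
  "cmod (cinner_l2 (blinfun_apply (schroedinger l p) \<phi>) \<psi>) \<le> norm \<phi> * norm \<psi>"
  using cmod_cinner_le[of "blinfun_apply (schroedinger l p) \<phi>" \<psi>] by (simp add: norm_schroedinger)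

lemma weak_integral_integrable:
  assumes "g \<in> heis_L1"
  shows "integrable lborel (\<lambda>q. g q * cinner_l2 (blinfun_apply (schroedinger l q) \<phi>) \<psi>)"
proof (rule Bochner_Integration.integrable_bound)
  note [measurable] = heis_L1_measurable[OF assms]
  show "integrable lborel (\<lambda>q. (norm \<phi> * norm \<psi>) * cmod (g q))"
    using assms by (simp add: heis_L1_def)
  show "(\<lambda>q. g q * cinner_l2 (blinfun_apply (schroedinger l q) \<phi>) \<psi>) \<in> borel_measurable lborel"
    by measurable
  show "AE q in lborel. norm (g q * cinner_l2 (blinfun_apply (schroedinger l q) \<phi>) \<psi>)
      \<le> norm ((norm \<phi> * norm \<psi>) * cmod (g q))"
    by (intro AE_I2)
       (simp add: norm_mult mult.commute[of "cmod (g _)"] mult_right_mono cmod_schroedinger_coefficient_le)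
qed

lemma weak_integral_bounded_linear:
  assumes g: "g \<in> heis_L1"
  shows "bounded_linear (\<lambda>\<psi>. \<integral>q. g q * cinner_l2 (blinfun_apply (schroedinger l q) \<phi>) \<psi> \<partial>lborel)"
proof (rule bounded_linear_intro[where K = "L1_norm g * norm \<phi>"])
  fix \<psi> \<psi>' and r :: real
  let ?I = "\<lambda>\<psi>. \<integral>q. g q * cinner_l2 (blinfun_apply (schroedinger l q) \<phi>) \<psi> \<partial>lborel"
  show "?I (\<psi> + \<psi>') = ?I \<psi> + ?I \<psi>'"
    by (simp add: cinner_add_right distrib_left weak_integral_integrable g)
  show "?I (r *\<^sub>R \<psi>) = r *\<^sub>R ?I \<psi>"
    by (simp add: cinner_scaleR_right)
  have "norm (?I \<psi>) \<le> (\<integral>q. norm (g q * cinner_l2 (blinfun_apply (schroedinger l q) \<phi>) \<psi>) \<partial>lborel)"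
    by (rule integral_norm_bound)
  also have "\<dots> \<le> (\<integral>q. cmod (g q) * (norm \<phi> * norm \<psi>) \<partial>lborel)"
    using g weak_integral_integrable[OF g]
    by (intro integral_mono integrable_norm)
       (auto simp: heis_L1_def norm_mult intro: mult_left_mono cmod_schroedinger_coefficient_le)
  finally show "norm (?I \<psi>) \<le> norm \<psi> * (L1_norm g * norm \<phi>)"
    by (simp add: L1_norm_def mult_ac)
qed


section \<open>Covariant representations and the group Fourier transform\<close>

locale covariant_representation = L1_star_representation B
  for B :: "('n::finite heis \<Rightarrow> complex) \<Rightarrow> (real ^ 'n) l2_op" +
  fixes l :: real
  assumes nonzero_l: "l \<noteq> 0"
    and translate: "\<And>f p. f \<in> heis_L1 \<Longrightarrow> B (heis_translate p f) = B f o\<^sub>L op_adjoint (schroedinger l p)"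
begin

lemma B_schroedinger:
  "f \<in> heis_L1 \<Longrightarrow>
    blinfun_apply (B f) (blinfun_apply (schroedinger l p) \<phi>) = blinfun_apply (B (heis_translate (- p) f)) \<phi>"
  by (simp add: translate op_adjoint_schroedinger)

text \<open>
  The convolution \<open>f\<^sup>* * g\<close> is the integral of the right translates of \<open>f\<^sup>*\<close> by \<open>-q\<close> with weight
  \<open>g q\<close>, and a coefficient of \<open>B\<close> may be taken under this integral. Moving \<open>B (f\<^sup>*)\<close> to the second
  argument then leaves the coefficients of \<open>B g\<close> and \<open>\<pi>(q)\<close> against the range of \<open>B f\<close>.
\<close>

lemma weak_formula_on_range:
  assumes f: "f \<in> heis_L1" and g: "g \<in> heis_L1"
  shows "cinner_l2 (blinfun_apply (B g) \<phi>) (blinfun_apply (B f) \<psi>)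
    = (\<integral>q. g q * cinner_l2 (blinfun_apply (schroedinger l q) \<phi>) (blinfun_apply (B f) \<psi>) \<partial>lborel)"
proof -
  let ?f = "heis_star f"
  have fs: "?f \<in> heis_L1" by (rule heis_L1_star[OF f])
  have adj: "cinner_l2 (blinfun_apply (B ?f) \<theta>) \<psi> = cinner_l2 \<theta> (blinfun_apply (B f) \<psi>)" for \<theta>
    using cinner_star[OF fs] by (simp add: heis_star_star)
  interpret L: L1_functional lborel "lborel :: 'n heis measure"
      "\<lambda>f. cinner_l2 (blinfun_apply (B f) \<phi>) \<psi>" "norm \<phi> * norm \<psi>"
    by (rule coefficient_functional)
  obtain v where v: "integrable lborel v"
    "AE q in lborel. v q = cinner_l2 (blinfun_apply (B (\<lambda>p. ?f (heis_mult p (- q)) * g q)) \<phi>) \<psi>"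
    "(\<integral>q. v q \<partial>lborel) = cinner_l2 (blinfun_apply (B (heis_conv ?f g)) \<phi>) \<psi>"
    using L.functional_integral_commute[OF heis_conv_kernel(1)[OF fs g]]
    unfolding L.commutes_def by (auto simp: heis_conv_def[abs_def])
  \<comment> \<open>The section of the kernel at \<open>q\<close> is \<open>g q\<close> times a right translate, which \<open>B\<close> turns into \<open>\<pi>(q)\<close>.\<close>
  have section_eq: "cinner_l2 (blinfun_apply (B (\<lambda>p. ?f (heis_mult p (- q)) * g q)) \<phi>) \<psi>
      = g q * cinner_l2 (blinfun_apply (schroedinger l q) \<phi>) (blinfun_apply (B f) \<psi>)" for q
  proof -
    have "cinner_l2 (blinfun_apply (B (\<lambda>p. g q * heis_translate (- q) ?f p)) \<phi>) \<psi>
        = g q * cinner_l2 (blinfun_apply (B (heis_translate (- q) ?f)) \<phi>) \<psi>"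
      using heis_L1_translate(1)[OF fs] by (intro L.L_cmult) (simp add: heis_L1_def)
    also have "\<dots> = g q * cinner_l2 (blinfun_apply (schroedinger l q) \<phi>) (blinfun_apply (B f) \<psi>)"
      by (simp add: B_schroedinger[OF fs, symmetric] adj)
    finally show ?thesis by (simp add: heis_translate_def mult.commute)
  qed
  have "cinner_l2 (blinfun_apply (B g) \<phi>) (blinfun_apply (B f) \<psi>) = (\<integral>q. v q \<partial>lborel)"
    by (simp add: v(3) conv[OF fs g] adj)
  also have "\<dots> = (\<integral>q. g q * cinner_l2 (blinfun_apply (schroedinger l q) \<phi>) (blinfun_apply (B f) \<psi>) \<partial>lborel)"
    using v(1,2) weak_integral_integrable[OF g] by (intro integral_cong_AE) (auto simp: section_eq)
  finally show ?thesis .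
qed

text \<open>
  The defect of the weak formula is a bounded functional of the second vector, hence given by a
  vector \<open>w\<close> orthogonal to the range of every \<open>B f\<close>. By covariance so are all \<open>\<pi>(p) w\<close>, and
  irreducibility leaves only \<open>w = 0\<close> unless \<open>B\<close> vanishes.
\<close>

lemma weak_formula:
  assumes nontrivial: "\<exists>f\<in>heis_L1. B f \<noteq> 0" and g: "g \<in> heis_L1"
  shows "cinner_l2 (blinfun_apply (B g) \<phi>) \<psi>
    = (\<integral>q. g q * cinner_l2 (blinfun_apply (schroedinger l q) \<phi>) \<psi> \<partial>lborel)"
proof -
  define D where "D \<psi> = cinner_l2 (blinfun_apply (B g) \<phi>) \<psi>
    - (\<integral>q. g q * cinner_l2 (blinfun_apply (schroedinger l q) \<phi>) \<psi> \<partial>lborel)" for \<psi>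
  have "bounded_linear (\<lambda>\<psi>. cnj (D \<psi>))"
    unfolding D_def
    by (intro bounded_linear_compose[OF bounded_linear_cnj] bounded_linear_sub
          bounded_linear_cinner_right weak_integral_bounded_linear g)
  moreover have "cnj (D (scaleC_l2 c \<psi>)) = c * cnj (D \<psi>)" for c \<psi>
    by (simp add: D_def cinner_scaleC_right mult.left_commute[of _ "cnj c"] right_diff_distrib)
  ultimately obtain w where w: "\<And>\<psi>. cnj (D \<psi>) = cinner_l2 \<psi> w"
    using complex_riesz_representation[of "\<lambda>\<psi>. cnj (D \<psi>)"] by blast
  have range: "cinner_l2 (blinfun_apply (B f) \<psi>) w = 0" if "f \<in> heis_L1" for f \<psi>
    unfolding w[symmetric] D_def by (simp add: weak_formula_on_range[OF that g])
  obtain f where f: "f \<in> heis_L1" "B f \<noteq> 0"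
    using nontrivial by blast
  then obtain \<theta> where \<theta>: "blinfun_apply (B f) \<theta> \<noteq> 0"
    by (metis blinfun_eqI zero_blinfun.rep_eq)
  have "cinner_l2 (blinfun_apply (schroedinger l p) w) (blinfun_apply (B f) \<theta>) = 0" for p
  proof -
    let ?f = "heis_star f"
    have fs: "?f \<in> heis_L1" by (rule heis_L1_star[OF f(1)])
    have ft: "heis_translate (- p) ?f \<in> heis_L1" by (rule heis_L1_translate[OF fs])
    have "cinner_l2 (blinfun_apply (schroedinger l p) w) (blinfun_apply (B f) \<theta>)
        = cinner_l2 (blinfun_apply (B (heis_translate (- p) ?f)) w) \<theta>"
      using cinner_star[OF fs] by (simp add: heis_star_star B_schroedinger[OF fs, symmetric])
    also have "\<dots> = cinner_l2 w (blinfun_apply (B (heis_star (heis_translate (- p) ?f))) \<theta>)"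
      by (rule cinner_star[OF ft])
    also have "\<dots> = 0"
      by (subst cinner_commute) (simp add: range heis_L1_star[OF ft])
    finally show ?thesis .
  qed
  then have "w = 0"
    using schroedinger_coefficients_zero[OF nonzero_l] \<theta> by blast
  then have "D \<psi> = 0"
    using w[of \<psi>] by simp
  then show ?thesis by (simp add: D_def)
qed

lemma eq_group_fourier:
  assumes "\<exists>f\<in>heis_L1. B f \<noteq> 0" "g \<in> heis_L1"
  shows "B g = group_fourier g l"
proof -
  have "group_fourier g l = B g"
    unfolding group_fourier_def
  proof (rule the_equality)
    show "B g \<in> bounded_ops \<and> (\<forall>\<phi> \<psi>. cinner_l2 (blinfun_apply (B g) \<phi>) \<psi>
        = (\<integral>p. g p * cinner_l2 (blinfun_apply (schroedinger l p) \<phi>) \<psi> \<partial>lborel))"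
      using bounded weak_formula assms by blast
    then show "A = B g" if "A \<in> bounded_ops \<and> (\<forall>\<phi> \<psi>. cinner_l2 (blinfun_apply A \<phi>) \<psi>
        = (\<integral>p. g p * cinner_l2 (blinfun_apply (schroedinger l p) \<phi>) \<psi> \<partial>lborel))" for A
      using that by (intro bounded_op_eqI) simp
  qed
  then show ?thesis ..
qed

end

theorem theorem4p2:
  fixes T :: "((complex ^ 'n) \<times> real \<Rightarrow> complex) \<Rightarrow> real \<Rightarrow> (real ^ 'n::finite) l2_op"
  assumes "L1_Linfty_map T"
    and "linear_into_ops T"
    and "continuous_into_ops T"
    and nonzero: "\<exists>f\<in>heis_L1. \<exists>l. l \<noteq> 0 \<and> T f l \<noteq> 0"
    and star: "\<And>l f. l \<noteq> 0 \<Longrightarrow> f \<in> heis_L1 \<Longrightarrow> T (heis_star f) l = op_adjoint (T f l)"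
    and conv: "\<And>l f g. l \<noteq> 0 \<Longrightarrow> f \<in> heis_L1 \<Longrightarrow> g \<in> heis_L1 \<Longrightarrow>
      T (heis_conv f g) l = T f l o\<^sub>L T g l"
    and translate: "\<And>l f p. l \<noteq> 0 \<Longrightarrow> f \<in> heis_L1 \<Longrightarrow>
      T (heis_translate p f) l = T f l o\<^sub>L op_adjoint (schroedinger l p)"
  shows "\<forall>l \<in> {l. l \<noteq> 0 \<and> (\<exists>f\<in>heis_L1. T f l \<noteq> 0)}. \<forall>f\<in>heis_L1. T f l = group_fourier f l"
proof (intro ballI)
  fix l and g :: "'n heis \<Rightarrow> complex"
  assume "l \<in> {l. l \<noteq> 0 \<and> (\<exists>f\<in>heis_L1. T f l \<noteq> 0)}" and g: "g \<in> heis_L1"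
  then have l: "l \<noteq> 0" "\<exists>f\<in>heis_L1. T f l \<noteq> 0" by auto
  interpret covariant_representation "\<lambda>f. T f l" l
  proof
    show "T f l \<in> bounded_ops" if "f \<in> heis_L1" for f
    proof -
      have "T f \<in> Linfty_ops"
        using assms(1) that unfolding L1_Linfty_map_def by blast
      then show ?thesis
        using l(1) by (simp add: Linfty_ops_def)
    qed
    show "T f l = T h l" if "f \<in> heis_L1" "h \<in> heis_L1" "AE p in lborel. f p = h p" for f h
      using assms(1) that l(1) unfolding L1_Linfty_map_def by blast
    show "blinfun_apply (T (\<lambda>p. a * f p + b * h p) l) \<phi>
        = scaleC_l2 a (blinfun_apply (T f l) \<phi>) + scaleC_l2 b (blinfun_apply (T h l) \<phi>)"
      if "f \<in> heis_L1" "h \<in> heis_L1" for f h a b \<phi>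
      using assms(2) that l(1) unfolding linear_into_ops_def by blast
  qed (use l(1) star conv translate in blast)+
  show "T g l = group_fourier g l"
    by (rule eq_group_fourier[OF l(2) g])
qed

end
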